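(* Let $A\subseteq\omega$ be any set. 1. $A$ is autocomplex if and only if $A$ (Turing-)computes a DNR function. 2. The following are equivalent: (a) $A$ is complex; (b) $A$ $tt$-computes a DNR function (i.e. there is a DNR function $f\le_{tt}A$); (c) $A$ $wtt$-computes a DNR function (i.e. there is a DNR function $f\le_{wtt}A$).
   Context: Fix an acceptable numbering $\varphi_0,\varphi_1,\dots$ of the partial recursive functions. $C$ denotes plain Kolmogorov complexity with respect to a fixed universal machine on binary strings. $A\upharpoonright y$ is the binary string $A(0)\ldots A(y-1)$. A function $g:\omega\to\omega$ is an order function if it is recursive, nondecreasing and unbounded; it is an $A$-order function if it is recursive in $A$, nondecreasing and unbounded. A set $A$ is complex if there is an order function $g$ with $C(A\upharpoonright y)\ge g(y)$ for all $y$. A set $A$ is autocomplex if there is an $A$-order function $g$ with $C(A\upharpoonright y)\ge g(y)$ for all $y$. A total function $f:\omega\to\omega$ is diagonally nonrecursive (DNR) if $f(x)\neq\varphi_x(x)$ for every $x$ with $\varphi_x(x)$ defined. $f\le_{wtt}A$ means $f$ is computed from $A$ by a Turing reduction whose use is bounded by a recursive function of the input; $f\le_{tt}A$ means $f$ is computed from $A$ by a Turing reduction that is total for every oracle. *)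

theory Defs
  imports Main
begin

section \<open>Oracle programs: Kleene's schemes for functions recursive in a set\<close>

datatype prog =
    Zero
  | Succ
  | Proj nat
  | Oracle
  | Comp prog "prog list"
  | PrimRec prog prog
  | Mu prog

text \<open>
  \<open>runs A p xs y Q\<close>: with oracle \<open>A\<close>, program \<open>p\<close> halts on input \<open>xs\<close> with output \<open>y\<close>, and
  \<open>Q\<close> is the set of numbers about which the oracle is queried in this computation.
\<close>

inductive runs :: "nat set \<Rightarrow> prog \<Rightarrow> nat list \<Rightarrow> nat \<Rightarrow> nat set \<Rightarrow> bool" for A where
  Zero: "runs A Zero xs 0 {}"
| Succ: "runs A Succ [x] (Suc x) {}"
| Proj: "i < length xs \<Longrightarrow> runs A (Proj i) xs (xs ! i) {}"
| Oracle: "runs A Oracle [x] (if x \<in> A then 1 else 0) {x}"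
| Comp: "\<lbrakk>length ys = length gs; \<forall>i<length gs. runs A (gs ! i) xs (ys ! i) (Qs i);
          runs A f ys y Q\<rbrakk>
    \<Longrightarrow> runs A (Comp f gs) xs y (Q \<union> (\<Union>i<length gs. Qs i))"
| PrimRec_0: "runs A f xs y Q \<Longrightarrow> runs A (PrimRec f g) (0 # xs) y Q"
| PrimRec_Suc: "\<lbrakk>runs A (PrimRec f g) (n # xs) z Q; runs A g (n # z # xs) y Q'\<rbrakk>
    \<Longrightarrow> runs A (PrimRec f g) (Suc n # xs) y (Q \<union> Q')"
| Mu: "\<lbrakk>runs A f (n # xs) 0 (Qs n); \<forall>m<n. \<exists>v>0. runs A f (m # xs) v (Qs m)\<rbrakk>
    \<Longrightarrow> runs A (Mu f) xs n (\<Union>m\<le>n. Qs m)"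

inductive_cases runs_ZeroE: "runs A Zero xs y Q"
inductive_cases runs_SuccE: "runs A Succ xs y Q"
inductive_cases runs_ProjE: "runs A (Proj i) xs y Q"
inductive_cases runs_OracleE: "runs A Oracle xs y Q"
inductive_cases runs_CompE: "runs A (Comp f gs) xs y Q"
inductive_cases runs_PrimRec_0E: "runs A (PrimRec f g) (0 # xs) y Q"
inductive_cases runs_PrimRec_SucE: "runs A (PrimRec f g) (Suc n # xs) y Q"
inductive_cases runs_MuE: "runs A (Mu f) xs y Q"

lemma runs_deterministic:
  "runs A p xs y Q \<Longrightarrow> runs A p xs y' Q' \<Longrightarrow> y = y' \<and> Q = Q'"
proof (induction arbitrary: y' Q' rule: runs.induct)
  case (Comp ys gs xs Qs f y Q)
  from Comp.prems obtain ys' Qs' Q2 where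
    *: "length ys' = length gs" "\<forall>i<length gs. runs A (gs ! i) xs (ys' ! i) (Qs' i)"
       "runs A f ys' y' Q2" "Q' = Q2 \<union> (\<Union>i<length gs. Qs' i)"
    by (blast elim: runs_CompE)
  have eq: "ys ! i = ys' ! i \<and> Qs i = Qs' i" if "i < length gs" for i
    using Comp.IH(1) *(2) that by blast
  then have "ys = ys'" using Comp.hyps(1) *(1) by (auto intro: nth_equalityI)
  then show ?case using Comp.IH(2) *(3,4) eq by auto
next
  case (PrimRec_Suc f g n xs z Q y Q2)
  from PrimRec_Suc.prems obtain z' R R' where
    "runs A (PrimRec f g) (n # xs) z' R" "runs A g (n # z' # xs) y' R'" "Q' = R \<union> R'"
    by (blast elim: runs_PrimRec_SucE)
  then show ?case using PrimRec_Suc.IH by blast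
next
  case (Mu f n xs Qs)
  from Mu.prems obtain Qs' where
    *: "runs A f (y' # xs) 0 (Qs' y')" "\<forall>m<y'. \<exists>v>0. runs A f (m # xs) v (Qs' m)"
       "Q' = (\<Union>m\<le>y'. Qs' m)"
    by (blast elim: runs_MuE)
  have "\<not> y' < n" using Mu.IH(2) *(1) by fastforce
  moreover have "\<not> n < y'" using Mu.IH(1) *(2) by fastforce
  ultimately have "n = y'" by simp
  moreover have "Qs m = Qs' m" if "m \<le> n" for m
  proof (cases "m = n")
    case True
    then show ?thesis using Mu.IH(1) *(1) \<open>n = y'\<close> by blast
  next
    case False
    then show ?thesis using Mu.IH(2) *(2) \<open>n = y'\<close> that by (meson le_neq_implies_less)
  qed
  ultimately show ?case using *(3) by auto
qed (blast elim: runs_ZeroE runs_SuccE runs_ProjE runs_OracleE runs_PrimRec_0E)+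

section \<open>Recursive functions and reducibilities\<close>

fun oracle_free :: "prog \<Rightarrow> bool" where
  "oracle_free Oracle = False"
| "oracle_free (Comp f gs) = (oracle_free f \<and> (\<forall>g\<in>set gs. oracle_free g))"
| "oracle_free (PrimRec f g) = (oracle_free f \<and> oracle_free g)"
| "oracle_free (Mu f) = oracle_free f"
| "oracle_free _ = True"

text \<open>An oracle-free program ignores its oracle, so the oracle \<open>{}\<close> below is immaterial.\<close>

definition partial_recursive :: "nat \<Rightarrow> (nat list \<Rightarrow> nat option) \<Rightarrow> bool" where
  "partial_recursive k F \<longleftrightarrow>
     (\<exists>p. oracle_free p \<and>
        (\<forall>xs y. length xs = k \<longrightarrow> F xs = Some y \<longleftrightarrow> (\<exists>Q. runs {} p xs y Q)))"

definition partial_recursive1 :: "(nat \<Rightarrow> nat option) \<Rightarrow> bool" where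
  "partial_recursive1 f \<longleftrightarrow> partial_recursive 1 (\<lambda>xs. f (xs ! 0))"

definition partial_recursive2 :: "(nat \<Rightarrow> nat \<Rightarrow> nat option) \<Rightarrow> bool" where
  "partial_recursive2 f \<longleftrightarrow> partial_recursive 2 (\<lambda>xs. f (xs ! 0) (xs ! 1))"

definition recursive :: "(nat \<Rightarrow> nat) \<Rightarrow> bool" where
  "recursive f \<longleftrightarrow> partial_recursive1 (\<lambda>x. Some (f x))"

definition turing_le :: "(nat \<Rightarrow> nat) \<Rightarrow> nat set \<Rightarrow> bool" (infix "\<le>T" 50) where
  "f \<le>T A \<longleftrightarrow> (\<exists>p. \<forall>x. \<exists>Q. runs A p [x] (f x) Q)"

definition wtt_le :: "(nat \<Rightarrow> nat) \<Rightarrow> nat set \<Rightarrow> bool" (infix "\<le>wtt" 50) where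
  "f \<le>wtt A \<longleftrightarrow>
     (\<exists>p h. recursive h \<and> (\<forall>x. \<exists>Q. runs A p [x] (f x) Q \<and> (\<forall>q\<in>Q. q < h x)))"

definition tt_le :: "(nat \<Rightarrow> nat) \<Rightarrow> nat set \<Rightarrow> bool" (infix "\<le>tt" 50) where
  "f \<le>tt A \<longleftrightarrow>
     (\<exists>p. (\<forall>X x. \<exists>y Q. runs X p [x] y Q) \<and> (\<forall>x. \<exists>Q. runs A p [x] (f x) Q))"

text \<open>
  A numbering of the unary partial recursive functions is acceptable if its universal function is
  partial recursive and every uniformly partial recursive sequence \<open>\<psi>\<close> of functions can be
  translated into it recursively (the enumeration and parameter theorems).
\<close>

definition acceptable_numbering :: "(nat \<Rightarrow> nat \<Rightarrow> nat option) \<Rightarrow> bool" where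
  "acceptable_numbering \<phi> \<longleftrightarrow>
     range \<phi> = {f. partial_recursive1 f} \<and>
     partial_recursive2 \<phi> \<and>
     (\<forall>\<psi>. partial_recursive2 \<psi> \<longrightarrow> (\<exists>s. recursive s \<and> (\<forall>e. \<phi> (s e) = \<psi> e)))"

definition dnr :: "(nat \<Rightarrow> nat \<Rightarrow> nat option) \<Rightarrow> (nat \<Rightarrow> nat) \<Rightarrow> bool" where
  "dnr \<phi> f \<longleftrightarrow> (\<forall>x y. \<phi> x x = Some y \<longrightarrow> f x \<noteq> y)"

section \<open>Plain Kolmogorov complexity\<close>

text \<open>The position of a string in the length-lexicographic order.\<close>

definition str_code :: "bool list \<Rightarrow> nat" where
  "str_code \<sigma> = foldl (\<lambda>n b. 2 * n + (if b then 2 else 1)) 0 \<sigma>"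

lemma str_code_Nil [simp]: "str_code [] = 0"
  and str_code_snoc [simp]: "str_code (\<sigma> @ [b]) = 2 * str_code \<sigma> + (if b then 2 else 1)"
  by (simp_all add: str_code_def)

lemma bij_str_code: "bij str_code"
proof (rule bijI)
  show "inj str_code"
  proof (rule injI)
    fix \<sigma> \<tau> show "str_code \<sigma> = str_code \<tau> \<Longrightarrow> \<sigma> = \<tau>"
    proof (induction \<sigma> arbitrary: \<tau> rule: rev_induct)
      case Nil
      then show ?case by (cases \<tau> rule: rev_cases) (auto split: if_splits)
    next
      case (snoc b \<sigma>)
      show ?case
      proof (cases \<tau> rule: rev_cases)
        case Nil
        then show ?thesis using snoc.prems by (auto split: if_splits)
      next
        case (snoc \<tau>' c)
        have "b = c \<and> str_code \<sigma> = str_code \<tau>'"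
          using snoc.prems snoc by (cases b; cases c; simp; presburger)
        then show ?thesis using snoc.IH snoc by blast
      qed
    qed
  qed
  have "\<exists>\<sigma>. str_code \<sigma> = n" for n
  proof (induction n rule: less_induct)
    case (less n)
    show ?case
    proof (cases "n = 0")
      case True
      then show ?thesis by (metis str_code_Nil)
    next
      case False
      then have "(n - 1) div 2 < n" by auto
      then obtain \<sigma> where "str_code \<sigma> = (n - 1) div 2" using less by blast
      then have "str_code (\<sigma> @ [even n]) = n" using False by (auto elim!: evenE oddE)
      then show ?thesis by blast
    qed
  qed
  then show "surj str_code" by (metis surjI)
qed

definition machine :: "(bool list \<Rightarrow> bool list option) \<Rightarrow> bool" where
  "machine M \<longleftrightarrow>
     (\<exists>m. partial_recursive1 m \<and> (\<forall>\<sigma>. m (str_code \<sigma>) = map_option str_code (M \<sigma>)))"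

text \<open>
  Universality is understood as additive optimality. Machines \<open>U\<close> such that for every machine
  \<open>M\<close> there is a \<open>\<rho>\<close> with \<open>U (\<rho> @ \<tau>) = M \<tau>\<close> for all \<open>\<tau>\<close> are a special case.
\<close>

definition universal_machine :: "(bool list \<Rightarrow> bool list option) \<Rightarrow> bool" where
  "universal_machine U \<longleftrightarrow>
     machine U \<and>
     (\<forall>M. machine M \<longrightarrow>
        (\<exists>c. \<forall>\<tau> \<sigma>. M \<tau> = Some \<sigma> \<longrightarrow>
           (\<exists>\<tau>'. U \<tau>' = Some \<sigma> \<and> length \<tau>' \<le> length \<tau> + c)))"

text \<open>For universal \<open>U\<close> every string has a description, so the minimum is always attained.\<close>

definition plain_complexity :: "(bool list \<Rightarrow> bool list option) \<Rightarrow> bool list \<Rightarrow> nat" where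
  "plain_complexity U \<sigma> = (LEAST n. \<exists>\<tau>. U \<tau> = Some \<sigma> \<and> length \<tau> = n)"

section \<open>Complex and autocomplex sets\<close>

definition prefix_of :: "nat set \<Rightarrow> nat \<Rightarrow> bool list" (infixl "\<restriction>" 70) where
  "A \<restriction> y = map (\<lambda>i. i \<in> A) [0..<y]"

definition order_function :: "(nat \<Rightarrow> nat) \<Rightarrow> bool" where
  "order_function g \<longleftrightarrow> recursive g \<and> mono g \<and> (\<forall>n. \<exists>y. n \<le> g y)"

definition order_function_in :: "nat set \<Rightarrow> (nat \<Rightarrow> nat) \<Rightarrow> bool" where
  "order_function_in A g \<longleftrightarrow> g \<le>T A \<and> mono g \<and> (\<forall>n. \<exists>y. n \<le> g y)"

definition complex_set :: "(bool list \<Rightarrow> bool list option) \<Rightarrow> nat set \<Rightarrow> bool" where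
  "complex_set U A \<longleftrightarrow>
     (\<exists>g. order_function g \<and> (\<forall>y. plain_complexity U (A \<restriction> y) \<ge> g y))"

definition autocomplex_set :: "(bool list \<Rightarrow> bool list option) \<Rightarrow> nat set \<Rightarrow> bool" where
  "autocomplex_set U A \<longleftrightarrow>
     (\<exists>g. order_function_in A g \<and> (\<forall>y. plain_complexity U (A \<restriction> y) \<ge> g y))"

end

theory Submission
  imports Defs
begin

text \<open>
  Let \<open>g\<close> be an order function below the complexity of the prefixes of \<open>A\<close>. If \<open>F n\<close> is least with
  \<open>g (F n) > n + c\<close>, then \<open>A \<restriction> F n\<close> is too complex to be the \<open>n\<close>-th diagonal value, so its code is a
  DNR function of \<open>n\<close>. If \<open>g\<close> is recursive, this reduction is total for every oracle.

  Conversely, let \<open>p\<close> compute a DNR function \<open>f\<close> from \<open>A\<close> with use bounded by \<open>h\<close>. Let \<open>s k\<close> be an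
  index of the function computed by \<open>p\<close> with the string described by \<open>k\<close> as oracle. If that string is
  \<open>A \<restriction> y\<close> with \<open>y \<ge> h (s k)\<close>, then \<open>f (s k)\<close> is the diagonal value at \<open>s k\<close>, which is impossible.
  So a prefix of length at least \<open>h (s k)\<close> for all \<open>k < 2 ^ n\<close> has complexity at least \<open>n\<close>. The bound
  \<open>h\<close> can be found with \<open>A\<close>, and recursively for a truth-table reduction, by compactness.
\<close>

section \<open>Functions computable in a set\<close>

lemma runs_finite: "runs A p xs y Q \<Longrightarrow> finite Q"
proof (induction rule: runs.induct)
  case (Mu f n xs Qs)
  then have "finite (Qs m)" if "m \<le> n" for m
    using that by (metis le_neq_implies_less)
  then show ?case by simp
qed auto

text \<open>With the empty oracle every query is answered by 0, which \<open>Zero\<close> imitates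
  without asking. Since \<open>Zero\<close> accepts any number of arguments, the erased program may
  halt on more inputs; hence \<open>runs_erase\<close> goes in one direction only.\<close>

fun erase :: "prog \<Rightarrow> prog" where
  "erase Oracle = Zero"
| "erase (Comp f gs) = Comp (erase f) (map erase gs)"
| "erase (PrimRec f g) = PrimRec (erase f) (erase g)"
| "erase (Mu f) = Mu (erase f)"
| "erase p = p"

lemma oracle_free_erase: "oracle_free (erase p)"
  by (induction p rule: erase.induct) auto

lemma runs_erase: "runs {} p xs y Q \<Longrightarrow> runs X (erase p) xs y {}"
proof (induction rule: runs.induct)
  case (Comp ys gs xs Qs f y Q)
  then have "runs X (Comp (erase f) (map erase gs)) xs y ({} \<union> (\<Union>i<length (map erase gs). {}))"
    by (intro runs.Comp[where ys = ys]) auto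
  then show ?case by simp
next
  case (PrimRec_Suc f g n xs z Q y Q')
  then have "runs X (PrimRec (erase f) (erase g)) (Suc n # xs) y ({} \<union> {})"
    by (intro runs.PrimRec_Suc) auto
  then show ?case by simp
next
  case (Mu f n xs Qs)
  then have "runs X (Mu (erase f)) xs n (\<Union>m\<le>n. {})"
    by (intro runs.Mu) auto
  then show ?case by simp
qed (auto intro: runs.intros)

text \<open>Total functions on argument lists of the fixed length \<open>k\<close>. Programs may
  query \<open>A\<close>, so one set of closure properties serves both recursive functions
  (\<open>A = {}\<close>) and functions recursive in \<open>A\<close>.\<close>

definition computable :: "nat set \<Rightarrow> nat \<Rightarrow> (nat list \<Rightarrow> nat) \<Rightarrow> bool" where
  "computable A k F \<longleftrightarrow> (\<exists>p. \<forall>xs. length xs = k \<longrightarrow> (\<exists>Q. runs A p xs (F xs) Q))"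

definition decidable :: "nat set \<Rightarrow> nat \<Rightarrow> (nat list \<Rightarrow> bool) \<Rightarrow> bool" where
  "decidable A k P \<longleftrightarrow> computable A k (\<lambda>xs. of_bool (P xs))"

lemma computable_mono:
  assumes "computable {} k F"
  shows "computable A k F"
  using assms runs_erase unfolding computable_def by metis

lemma computable_cong:
  "(\<And>xs. length xs = k \<Longrightarrow> F xs = G xs) \<Longrightarrow> computable A k F \<longleftrightarrow> computable A k G"
  by (simp add: computable_def cong: imp_cong)

lemma turing_le_iff_computable: "f \<le>T A \<longleftrightarrow> computable A 1 (\<lambda>xs. f (xs ! 0))"
proof
  assume "f \<le>T A"
  then obtain p where p: "\<And>x. \<exists>Q. runs A p [x] (f x) Q" by (auto simp: turing_le_def)
  show "computable A 1 (\<lambda>xs. f (xs ! 0))"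
    unfolding computable_def
  proof (intro exI[of _ p] allI impI)
    fix xs :: "nat list" assume "length xs = 1"
    then obtain x where "xs = [x]" by (auto simp: length_Suc_conv)
    then show "\<exists>Q. runs A p xs (f (xs ! 0)) Q" using p by simp
  qed
next
  assume "computable A 1 (\<lambda>xs. f (xs ! 0))"
  then obtain p where p: "\<And>xs. length xs = 1 \<Longrightarrow> \<exists>Q. runs A p xs (f (xs ! 0)) Q"
    by (auto simp: computable_def)
  show "f \<le>T A"
    unfolding turing_le_def using p[of "[_]"] by auto
qed

text \<open>A program run with the empty oracle becomes oracle-free by \<open>erase\<close>, and
  determinism excludes any output other than \<open>f x\<close>.\<close>

lemma recursive_iff_computable: "recursive f \<longleftrightarrow> computable {} 1 (\<lambda>xs. f (xs ! 0))"
proof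
  assume "recursive f"
  then show "computable {} 1 (\<lambda>xs. f (xs ! 0))"
    by (auto simp: recursive_def partial_recursive1_def partial_recursive_def computable_def)
next
  assume "computable {} 1 (\<lambda>xs. f (xs ! 0))"
  then obtain p where "\<forall>xs. length xs = 1 \<longrightarrow> (\<exists>Q. runs {} p xs (f (xs ! 0)) Q)"
    by (auto simp: computable_def)
  then have p: "runs {} (erase p) xs (f (xs ! 0)) {}" if "length xs = 1" for xs
    using that runs_erase by blast
  show "recursive f"
    unfolding recursive_def partial_recursive1_def partial_recursive_def
    using p oracle_free_erase by (auto dest: runs_deterministic intro!: exI[of _ "erase p"])
qed

section \<open>Closure properties of the total computable functions\<close>

lemma computable_const_0: "computable A k (\<lambda>xs. 0)"
  unfolding computable_def by (blast intro: runs.Zero)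

lemma computable_nth: "i < k \<Longrightarrow> computable A k (\<lambda>xs. xs ! i)"
  unfolding computable_def by (blast intro: runs.Proj)

lemma computable_nth_drop: "n + i < k \<Longrightarrow> computable A k (\<lambda>xs. drop n xs ! i)"
  using computable_nth[of "n + i" k A] by (subst computable_cong[where G = "\<lambda>xs. xs ! (n + i)"]) auto

lemma computable_comp:
  assumes "computable A n F" "length gs = n" "\<And>g. g \<in> set gs \<Longrightarrow> computable A k g"
  shows "computable A k (\<lambda>xs. F (map (\<lambda>g. g xs) gs))"
proof -
  obtain p where p: "\<And>xs. length xs = n \<Longrightarrow> \<exists>Q. runs A p xs (F xs) Q"
    using assms(1) by (auto simp: computable_def)
  have "\<forall>g\<in>set gs. \<exists>q. \<forall>xs. length xs = k \<longrightarrow> (\<exists>Q. runs A q xs (g xs) Q)"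
    using assms(3) by (auto simp: computable_def)
  then obtain q where q: "\<And>g xs. g \<in> set gs \<Longrightarrow> length xs = k \<Longrightarrow> \<exists>Q. runs A (q g) xs (g xs) Q"
    by metis
  have "\<exists>Q. runs A (Comp p (map q gs)) xs (F (map (\<lambda>g. g xs) gs)) Q" if xs: "length xs = k" for xs
  proof -
    obtain Q where Q: "runs A p (map (\<lambda>g. g xs) gs) (F (map (\<lambda>g. g xs) gs)) Q"
      using p assms(2) by (metis length_map)
    obtain Qs where "\<forall>i<length gs. runs A (q (gs ! i)) xs ((gs ! i) xs) (Qs i)"
      using q[OF nth_mem xs] by metis
    then have "\<forall>i<length (map q gs). runs A (map q gs ! i) xs (map (\<lambda>g. g xs) gs ! i) (Qs i)"
      by simp
    from runs.Comp[OF _ this Q] show ?thesis by auto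
  qed
  then show ?thesis unfolding computable_def by blast
qed

lemma computable_app1:
  assumes "computable A 1 (\<lambda>xs. f (xs ! 0))" "computable A k F"
  shows "computable A k (\<lambda>xs. f (F xs))"
  using computable_comp[OF assms(1), of "[F]" k] assms(2) by simp

lemma map_nth_upt_eq_drop: "length xs = m \<Longrightarrow> map ((!) xs) [n..<m] = drop n xs"
  by (intro nth_equalityI) auto

text \<open>Recursion and search place their own variables in front of the parameters; this lifts a
  function of the parameters past them.\<close>

lemma computable_drop:
  assumes "computable A k F" "m = n + k"
  shows "computable A m (\<lambda>xs. F (drop n xs))"
proof -
  have "map ((!) xs) [n..<m] = drop n xs" if "length xs = m" for xs :: "nat list"
    using that by (rule map_nth_upt_eq_drop)
  moreover have "computable A m (\<lambda>xs. F (map (\<lambda>g. g xs) (map (\<lambda>i xs. xs ! i) [n..<m])))"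
    using assms by (intro computable_comp) (auto intro: computable_nth)
  ultimately show ?thesis by (subst computable_cong) (auto simp: comp_def)
qed

lemma computable_Suc:
  assumes "computable A k F"
  shows "computable A k (\<lambda>xs. Suc (F xs))"
proof (rule computable_app1[where f = Suc, OF _ assms])
  show "computable A 1 (\<lambda>xs. Suc (xs ! 0))"
    using turing_le_iff_computable[of Suc A] runs.Succ unfolding turing_le_def by blast
qed

lemma computable_const: "computable A k (\<lambda>xs. n)"
  by (induction n) (auto intro: computable_const_0 computable_Suc)

text \<open>\<open>PrimRec\<close> yields a function of the counter and the parameters. Substituting
  \<open>N\<close> for the counter and projections for the rest gives recursion up to a computed
  bound.\<close>

lemma computable_rec:
  assumes N: "computable A k N" and F: "computable A k F"
    and g: "computable A (Suc (Suc k)) (\<lambda>ys. g (ys ! 0) (ys ! 1) (drop 2 ys))"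
  shows "computable A k (\<lambda>xs. rec_nat (F xs) (\<lambda>m z. g m z xs) (N xs))"
proof -
  define R where "R = (\<lambda>n xs. rec_nat (F xs) (\<lambda>m z. g m z xs) n)"
  obtain p where p: "\<And>xs. length xs = k \<Longrightarrow> \<exists>Q. runs A p xs (F xs) Q"
    using F by (auto simp: computable_def)
  obtain q where q: "\<And>ys. length ys = Suc (Suc k) \<Longrightarrow>
      \<exists>Q. runs A q ys (g (ys ! 0) (ys ! 1) (drop 2 ys)) Q"
    using g by (auto simp: computable_def)
  have "\<exists>Q. runs A (PrimRec p q) (n # xs) (R n xs) Q" if "length xs = k" for n xs
  proof (induction n)
    case 0
    then show ?case using p[OF that] by (auto simp: R_def intro: runs.PrimRec_0)
  next
    case (Suc n)
    then show ?case using q[of "n # R n xs # xs"] that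
      by (auto simp: R_def intro: runs.PrimRec_Suc)
  qed
  then have "computable A (Suc k) (\<lambda>ys. R (hd ys) (tl ys))"
    unfolding computable_def by (intro exI[of _ "PrimRec p q"]) (auto simp: length_Suc_conv)
  then have "computable A k (\<lambda>xs. (\<lambda>ys. R (hd ys) (tl ys))
      (map (\<lambda>h. h xs) (N # map (\<lambda>i xs. xs ! i) [0..<k])))"
    using N by (intro computable_comp) (auto intro: computable_nth)
  moreover have "map ((!) xs) [0..<k] = xs" if "length xs = k" for xs :: "nat list"
    using that map_nth by blast
  ultimately show ?thesis
    by (subst computable_cong[where G = "\<lambda>xs. (\<lambda>ys. R (hd ys) (tl ys))
      (map (\<lambda>h. h xs) (N # map (\<lambda>i xs. xs ! i) [0..<k]))"]) (auto simp: comp_def R_def)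
qed

lemma computable_Least:
  assumes P: "decidable A (Suc k) (\<lambda>ys. P (ys ! 0) (drop 1 ys))"
    and ex: "\<And>xs. length xs = k \<Longrightarrow> \<exists>n. P n xs"
  shows "computable A k (\<lambda>xs. LEAST n. P n xs)"
proof -
  \<comment> \<open>\<open>Mu\<close> looks for a zero, whereas \<open>of_bool\<close> is 1 for
    true; this recursion exchanges 0 and 1.\<close>
  have "computable A (Suc k) (\<lambda>ys. rec_nat 1 (\<lambda>m z. 0) (of_bool (P (ys ! 0) (drop 1 ys))))"
    using P unfolding decidable_def by (intro computable_rec computable_const)
  then obtain p where p: "\<And>ys. length ys = Suc k \<Longrightarrow>
      \<exists>Q. runs A p ys (rec_nat 1 (\<lambda>m z. 0) (of_bool (P (ys ! 0) (drop 1 ys)))) Q"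
    by (auto simp: computable_def)
  have "\<exists>Q. runs A (Mu p) xs (LEAST n. P n xs) Q" if xs: "length xs = k" for xs
  proof -
    have "\<exists>Q. runs A p (n # xs) (if P n xs then 0 else 1) Q" for n
      using p[of "n # xs"] xs by (auto split: if_splits)
    then obtain Qs where Qs: "\<And>n. runs A p (n # xs) (if P n xs then 0 else 1) (Qs n)"
      by metis
    have "runs A p ((LEAST n. P n xs) # xs) 0 (Qs (LEAST n. P n xs))"
      using Qs[of "LEAST n. P n xs"] LeastI_ex[OF ex[OF xs]] by simp
    moreover have "\<exists>v>0. runs A p (m # xs) v (Qs m)" if "m < (LEAST n. P n xs)" for m
      using Qs[of m] not_less_Least[OF that] by (intro exI[of _ 1]) simp
    ultimately show ?thesis by (meson runs.Mu)
  qed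
  then show ?thesis unfolding computable_def by blast
qed

text \<open>Case distinction is a recursion of at most one step, over the truth value of the
  condition.\<close>

lemma computable_if:
  assumes "decidable A k P" "computable A k F" "computable A k G"
  shows "computable A k (\<lambda>xs. if P xs then F xs else G xs)"
proof -
  have "computable A k (\<lambda>xs. rec_nat (G xs) (\<lambda>m z. F xs) (of_bool (P xs)))"
    using assms unfolding decidable_def by (intro computable_rec computable_drop) auto
  moreover have "rec_nat (G xs) (\<lambda>m z. F xs) (of_bool (P xs)) = (if P xs then F xs else G xs)" for xs
    by simp
  ultimately show ?thesis by simp
qed

lemma computable_add:
  assumes "computable A k F" "computable A k G"
  shows "computable A k (\<lambda>xs. F xs + G xs)"
proof -
  have "rec_nat x (\<lambda>m z. Suc z) y = x + y" for x y :: nat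
    by (induction y) auto
  moreover have "computable A k (\<lambda>xs. rec_nat (F xs) (\<lambda>m z. Suc z) (G xs))"
    using assms by (intro computable_rec computable_Suc computable_nth) auto
  ultimately show ?thesis by simp
qed

lemma computable_pred:
  assumes "computable A k F"
  shows "computable A k (\<lambda>xs. F xs - 1)"
proof -
  have "rec_nat 0 (\<lambda>m z. m) y = y - 1" for y :: nat
    by (induction y) auto
  moreover have "computable A k (\<lambda>xs. rec_nat 0 (\<lambda>m z. m) (F xs))"
    using assms by (intro computable_rec computable_const computable_nth) auto
  ultimately show ?thesis by simp
qed

lemma computable_diff:
  assumes "computable A k F" "computable A k G"
  shows "computable A k (\<lambda>xs. F xs - G xs)"
proof -
  have "rec_nat x (\<lambda>m z. z - 1) y = x - y" for x y :: nat
    by (induction y) auto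
  moreover have "computable A k (\<lambda>xs. rec_nat (F xs) (\<lambda>m z. z - 1) (G xs))"
    using assms by (intro computable_rec computable_pred computable_nth) auto
  ultimately show ?thesis by simp
qed

section \<open>Decidable predicates\<close>

lemma decidable_le:
  assumes "computable A k F" "computable A k G"
  shows "decidable A k (\<lambda>xs. F xs \<le> G xs)"
proof -
  have "computable A k (\<lambda>xs. 1 - (F xs - G xs))"
    using assms by (intro computable_diff computable_const)
  moreover have "1 - (x - y) = of_bool (x \<le> y)" for x y :: nat by auto
  ultimately show ?thesis unfolding decidable_def by simp
qed

lemma decidable_not:
  assumes "decidable A k P"
  shows "decidable A k (\<lambda>xs. \<not> P xs)"
proof -
  have "computable A k (\<lambda>xs. 1 - of_bool (P xs))"
    using assms unfolding decidable_def by (intro computable_diff computable_const)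
  moreover have "1 - of_bool b = (of_bool (\<not> b) :: nat)" for b by simp
  ultimately show ?thesis unfolding decidable_def by simp
qed

lemma decidable_conj:
  assumes "decidable A k P" "decidable A k R"
  shows "decidable A k (\<lambda>xs. P xs \<and> R xs)"
proof -
  have "computable A k (\<lambda>xs. if P xs then of_bool (R xs) else 0)"
    using assms by (intro computable_if computable_const) (simp_all add: decidable_def)
  moreover have "(if b then of_bool c else 0) = (of_bool (b \<and> c) :: nat)" for b c by simp
  ultimately show ?thesis unfolding decidable_def by simp
qed

lemma decidable_disj:
  assumes "decidable A k P" "decidable A k R"
  shows "decidable A k (\<lambda>xs. P xs \<or> R xs)"
  using decidable_not[OF decidable_conj[OF decidable_not[OF assms(1)] decidable_not[OF assms(2)]]]
  by simp

lemma decidable_less: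
  assumes "computable A k F" "computable A k G"
  shows "decidable A k (\<lambda>xs. F xs < G xs)"
  using decidable_not[OF decidable_le[OF assms(2,1)]] by (simp add: not_le)

lemma decidable_eq:
  assumes "computable A k F" "computable A k G"
  shows "decidable A k (\<lambda>xs. F xs = G xs)"
proof -
  have "(\<lambda>xs. F xs = G xs) = (\<lambda>xs. F xs \<le> G xs \<and> G xs \<le> F xs)" by auto
  then show ?thesis using assms by (auto intro: decidable_conj decidable_le)
qed

lemma decidable_all_less:
  assumes N: "computable A k N"
    and P: "decidable A (Suc (Suc k)) (\<lambda>ys. P (ys ! 0) (drop 2 ys))"
  shows "decidable A k (\<lambda>xs. \<forall>c<N xs. P c xs)"
proof -
  have "rec_nat 1 (\<lambda>m z. if P m xs then z else 0) n = (of_bool (\<forall>c<n. P c xs) :: nat)"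
    for n xs
    by (induction n) (auto simp: less_Suc_eq)
  moreover have "computable A k (\<lambda>xs. rec_nat 1 (\<lambda>m z. if P m xs then z else 0) (N xs))"
    using assms by (intro computable_rec computable_if computable_const computable_nth) auto
  ultimately show ?thesis unfolding decidable_def by simp
qed

lemma computable_div2:
  assumes "computable A k F"
  shows "computable A k (\<lambda>xs. F xs div 2)"
proof -
  have "computable A k (\<lambda>xs. LEAST q. F xs \<le> Suc (q + q))"
    using assms
    by (intro computable_Least decidable_le computable_drop computable_Suc computable_add computable_nth)
      (simp_all, metis le_SucI le_add1)
  moreover have "(LEAST q. n \<le> Suc (q + q)) = n div 2" for n
    by (rule Least_equality) auto
  ultimately show ?thesis by simp
qed

lemma decidable_even:
  assumes "computable A k F"
  shows "decidable A k (\<lambda>xs. even (F xs))"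
proof -
  have "decidable A k (\<lambda>xs. F xs = F xs div 2 + F xs div 2)"
    using assms by (intro decidable_eq computable_add computable_div2)
  moreover have "n = n div 2 + n div 2 \<longleftrightarrow> even n" for n :: nat by presburger
  ultimately show ?thesis by simp
qed

lemmas computable_intros = computable_nth computable_nth_drop computable_Suc
  computable_if computable_add computable_pred computable_diff decidable_le decidable_not
  decidable_conj decidable_disj decidable_less decidable_eq computable_div2 decidable_even
  computable_const

section \<open>Strings as numbers\<close>

definition str_of :: "nat \<Rightarrow> bool list" where
  "str_of = inv str_code"

lemma str_of_str_code [simp]: "str_of (str_code \<sigma>) = \<sigma>"
  and str_code_str_of [simp]: "str_code (str_of n) = n"
  unfolding str_of_def
  by (rule inv_f_f[OF bij_is_inj[OF bij_str_code]], rule surj_f_inv_f[OF bij_is_surj[OF bij_str_code]])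

lemma str_code_eq_0_iff [simp]: "str_code \<sigma> = 0 \<longleftrightarrow> \<sigma> = []"
  by (metis str_code_Nil str_of_str_code)

lemma length_le_str_code: "length \<sigma> \<le> str_code \<sigma>"
  by (induction \<sigma> rule: rev_induct) auto

lemma str_code_less: "str_code \<sigma> < 2 ^ Suc (length \<sigma>)"
proof -
  \<comment> \<open>The summand 2 carries the induction: appending a bit turns a code
    \<open>z\<close> into at most \<open>2 * z + 2\<close>, and \<open>2 * z + 4\<close> is twice
    \<open>z + 2\<close>.\<close>
  have "str_code \<sigma> + 2 \<le> 2 ^ Suc (length \<sigma>)"
    by (induction \<sigma> rule: rev_induct) auto
  then show ?thesis by linarith
qed

lemma str_code_butlast: "str_code (butlast \<sigma>) = (str_code \<sigma> - 1) div 2"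
  by (cases \<sigma> rule: rev_cases) auto

text \<open>\<open>(z - 1) div 2\<close> deletes the last bit and leaves the empty string as it is.
  Since bits can be removed only at the end of a code, prefixes are addressed by the number of bits
  removed.\<close>

lemma str_code_take:
  "str_code (take (length \<sigma> - j) \<sigma>) = rec_nat (str_code \<sigma>) (\<lambda>m z. (z - 1) div 2) j"
proof (induction j)
  case (Suc j)
  have "take (length \<sigma> - Suc j) \<sigma> = butlast (take (length \<sigma> - j) \<sigma>)"
    by (simp add: butlast_take)
  then show ?case using Suc by (simp add: str_code_butlast)
qed simp

lemma computable_str_take:
  assumes "computable A k F" "computable A k G"
  shows "computable A k (\<lambda>xs. str_code (take (length (str_of (F xs)) - G xs) (str_of (F xs))))"
proof -
  have "computable A k (\<lambda>xs. rec_nat (F xs) (\<lambda>m z. (z - 1) div 2) (G xs))"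
    using assms by (intro computable_rec computable_div2 computable_pred computable_nth) auto
  then show ?thesis by (simp add: str_code_take)
qed

lemma computable_length:
  assumes "computable A k F"
  shows "computable A k (\<lambda>xs. length (str_of (F xs)))"
proof -
  have "(LEAST j. str_code (take (length \<sigma> - j) \<sigma>) = 0) = length \<sigma>" for \<sigma>
    by (rule Least_equality) auto
  moreover have "computable A k
      (\<lambda>xs. LEAST j. str_code (take (length (str_of (F xs)) - j) (str_of (F xs))) = 0)"
    by (intro computable_Least decidable_eq computable_str_take computable_drop[OF assms]
        computable_nth computable_const)
      (auto intro: exI[of _ "length _"])
  ultimately show ?thesis by simp
qed

text \<open>Partial values are coded by numbers: \<open>0\<close> is undefined and \<open>Suc y\<close> is the value \<open>y\<close>.\<close>

definition query :: "bool list \<Rightarrow> nat \<Rightarrow> nat" where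
  "query \<sigma> q = (if q < length \<sigma> then Suc (of_bool (\<sigma> ! q)) else 0)"

lemma computable_query:
  assumes "computable A k F" "computable A k G"
  shows "computable A k (\<lambda>xs. query (str_of (F xs)) (G xs))"
proof -
  \<comment> \<open>Bit \<open>q\<close> is the last bit of the prefix of length
    \<open>Suc q\<close>, and a nonempty string ends in \<open>True\<close> iff its code is
    even.\<close>
  have *: "query \<sigma> q = (if q < length \<sigma> then Suc (if even (str_code
      (take (length \<sigma> - (length \<sigma> - Suc q)) \<sigma>)) then 1 else 0) else 0)" for \<sigma> q
    by (auto simp: query_def take_Suc_conv_app_nth)
  show ?thesis unfolding *
    using assms by (intro computable_intros computable_length computable_str_take)
qed

lemma length_prefix_of [simp]: "length (A \<restriction> y) = y"
  by (simp add: prefix_of_def)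

lemma nth_prefix_of [simp]: "q < y \<Longrightarrow> (A \<restriction> y) ! q \<longleftrightarrow> q \<in> A"
  by (simp add: prefix_of_def)

lemma prefix_of_0 [simp]: "A \<restriction> 0 = []"
  and prefix_of_Suc: "A \<restriction> Suc y = A \<restriction> y @ [y \<in> A]"
  by (simp_all add: prefix_of_def)

text \<open>One program has to serve all oracles, as a truth-table reduction will be built from it;
  \<open>computable\<close> would allow a different program for each oracle.\<close>

lemma prefix_program: "\<exists>p. \<forall>X y. \<exists>Q. runs X p [y] (str_code (X \<restriction> y)) Q"
proof -
  have "computable {} 2 (\<lambda>xs. xs ! 0 + xs ! 0 + Suc (xs ! 1))"
    by (intro computable_intros) auto
  then obtain d0 where d0: "\<And>xs. length xs = 2 \<Longrightarrow>
      \<exists>Q. runs {} d0 xs (xs ! 0 + xs ! 0 + Suc (xs ! 1)) Q"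
    by (auto simp: computable_def)
  \<comment> \<open>Erasing makes the arithmetic part behave in the same way under every
    oracle.\<close>
  define d where "d = erase d0"
  have d: "runs X d [z, b] (z + z + Suc b) {}" for X z b
    using d0[of "[z, b]"] by (auto simp: d_def intro: runs_erase)
  define p where "p = PrimRec Zero (Comp d [Proj 1, Comp Oracle [Proj 0]])"
  have "\<exists>Q. runs X p [y] (str_code (X \<restriction> y)) Q" for X y
  proof (induction y)
    case 0
    then show ?case by (auto simp: p_def intro!: exI runs.PrimRec_0 runs.Zero)
  next
    case (Suc y)
    then obtain Q where Q: "runs X p [y] (str_code (X \<restriction> y)) Q" by blast
    let ?z = "str_code (X \<restriction> y)"
    let ?b = "if y \<in> X then 1 else 0 :: nat"
    have "runs X (Comp Oracle [Proj 0]) [y, ?z] ?b ({y} \<union> (\<Union>i<length [Proj 0]. {}))"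
      using runs.Proj[of 0 "[y, ?z]" X]
      using runs.Oracle[of X y] by (intro runs.Comp[where ys = "[y]"]) auto
    then have o: "runs X (Comp Oracle [Proj 0]) [y, ?z] ?b {y}" by simp
    have "runs X (Comp d [Proj 1, Comp Oracle [Proj 0]]) [y, ?z] (?z + ?z + Suc ?b)
        ({} \<union> (\<Union>i<length [Proj 1, Comp Oracle [Proj 0]]. if i = 0 then {} else {y}))"
      using o d[of X ?z ?b] runs.Proj[of 1 "[y, ?z]" X]
      by (intro runs.Comp[where ys = "[?z, ?b]"]) (auto simp: less_Suc_eq)
    from runs.PrimRec_Suc[OF Q[unfolded p_def] this]
    show ?case by (auto simp: p_def prefix_of_Suc mult_2)
  qed
  then show ?thesis by blast
qed

lemma computable_prefix:
  assumes "computable A k F"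
  shows "computable A k (\<lambda>xs. str_code (A \<restriction> F xs))"
proof (rule computable_app1[where f = "\<lambda>y. str_code (A \<restriction> y)", OF _ assms])
  show "computable A 1 (\<lambda>xs. str_code (A \<restriction> xs ! 0))"
    using prefix_program turing_le_iff_computable[of "\<lambda>y. str_code (A \<restriction> y)" A]
    unfolding turing_le_def by blast
qed

section \<open>Approximating oracle computations\<close>

text \<open>
  The string is the known part of the oracle. A query outside it makes the result undefined, as does
  an unbounded search of \<open>t\<close> or more steps.
\<close>

fun approx :: "prog \<Rightarrow> bool list \<Rightarrow> nat \<Rightarrow> nat list \<Rightarrow> nat" where
  "approx Zero \<sigma> t xs = 1"
| "approx Succ \<sigma> t xs = (if length xs = 1 then Suc (Suc (xs ! 0)) else 0)"
| "approx (Proj i) \<sigma> t xs = (if i < length xs then Suc (xs ! i) else 0)"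
| "approx Oracle \<sigma> t xs = (if length xs = 1 then query \<sigma> (xs ! 0) else 0)"
| "approx (Comp f gs) \<sigma> t xs =
     (if \<exists>g\<in>set gs. approx g \<sigma> t xs = 0 then 0
      else approx f \<sigma> t (map (\<lambda>g. approx g \<sigma> t xs - 1) gs))"
| "approx (PrimRec f g) \<sigma> t xs =
     (if xs = [] then 0
      else rec_nat (approx f \<sigma> t (tl xs))
        (\<lambda>m z. if z = 0 then 0 else approx g \<sigma> t (m # (z - 1) # tl xs)) (hd xs))"
| "approx (Mu f) \<sigma> t xs =
     (let n = LEAST n. n = t \<or> approx f \<sigma> t (n # xs) \<le> 1
      in if n < t \<and> approx f \<sigma> t (n # xs) = 1 then Suc n else 0)"

text \<open>A coded result 1 is the value zero and 0 means undefined. The search stops at either of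
  them or at \<open>t\<close>, and it succeeds only if it stops before \<open>t\<close> with
  1.\<close>

lemma approx_Mu_iff:
  "approx (Mu f) \<sigma> t xs = Suc n \<longleftrightarrow>
     n < t \<and> approx f \<sigma> t (n # xs) = 1 \<and> (\<forall>m<n. approx f \<sigma> t (m # xs) > 1)"
    (is "?L \<longleftrightarrow> ?R")
proof
  assume ?L
  then have "n = (LEAST n. n = t \<or> approx f \<sigma> t (n # xs) \<le> 1)" "n < t" "approx f \<sigma> t (n # xs) = 1"
    by (auto simp: Let_def split: if_splits)
  then show ?R using not_less_Least by (metis not_le)
next
  assume ?R
  then have "(LEAST n. n = t \<or> approx f \<sigma> t (n # xs) \<le> 1) = n"
    by (intro Least_equality) (auto simp: not_less[symmetric])
  then show ?L using \<open>?R\<close> by simp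
qed

lemma approx_Comp_iff:
  "approx (Comp f gs) \<sigma> t xs = Suc y \<longleftrightarrow>
     (\<exists>ys. length ys = length gs \<and> (\<forall>i<length gs. approx (gs ! i) \<sigma> t xs = Suc (ys ! i)) \<and>
       approx f \<sigma> t ys = Suc y)" (is "?L \<longleftrightarrow> ?R")
proof
  assume L: ?L
  then have "approx (gs ! i) \<sigma> t xs > 0" if "i < length gs" for i
    using that nth_mem by (fastforce split: if_splits)
  moreover have "approx f \<sigma> t (map (\<lambda>g. approx g \<sigma> t xs - 1) gs) = Suc y"
    using L by (auto split: if_splits)
  ultimately show ?R by (intro exI[of _ "map (\<lambda>g. approx g \<sigma> t xs - 1) gs"]) simp
next
  assume ?R
  then obtain ys where ys: "length ys = length gs"
    "\<And>i. i < length gs \<Longrightarrow> approx (gs ! i) \<sigma> t xs = Suc (ys ! i)" "approx f \<sigma> t ys = Suc y" by blast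
  have "map (\<lambda>g. approx g \<sigma> t xs - 1) gs = ys"
    using ys(1,2) by (intro nth_equalityI) auto
  moreover have "\<not> (\<exists>g\<in>set gs. approx g \<sigma> t xs = 0)"
    using ys(2) by (metis in_set_conv_nth nat.distinct(1))
  ultimately show ?L using ys(3) by simp
qed

lemma approx_PrimRec_Suc_iff:
  "approx (PrimRec f g) \<sigma> t (Suc n # xs) = Suc y \<longleftrightarrow>
     (\<exists>z. approx (PrimRec f g) \<sigma> t (n # xs) = Suc z \<and> approx g \<sigma> t (n # z # xs) = Suc y)"
proof -
  define z where "z = approx (PrimRec f g) \<sigma> t (n # xs)"
  have "approx (PrimRec f g) \<sigma> t (Suc n # xs) = (if z = 0 then 0 else approx g \<sigma> t (n # (z - 1) # xs))"
    unfolding z_def approx.simps list.sel by simp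
  then show ?thesis unfolding z_def[symmetric] by (cases z) auto
qed

text \<open>Only queries below \<open>l\<close> are answered, and the string answers them as
  \<open>A\<close> does. So a defined approximation yields a true computation together with a bound
  on its use.\<close>

lemma approx_sound:
  "approx p (A \<restriction> l) t xs = Suc y \<Longrightarrow> \<exists>Q\<subseteq>{..<l}. runs A p xs y Q"
proof (induction p arbitrary: xs y)
  case Zero
  then show ?case by (auto intro!: exI[of _ "{}"] runs.Zero)
next
  case Succ
  then show ?case by (auto simp: length_Suc_conv split: if_splits intro!: exI[of _ "{}"] runs.Succ)
next
  case (Proj i)
  then show ?case by (auto split: if_splits intro!: exI[of _ "{}"] runs.Proj)
next
  case Oracle
  then obtain x where "xs = [x]" "x < l" "y = (if x \<in> A then 1 else 0)"
    by (auto simp: length_Suc_conv query_def split: if_splits)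
  then show ?case using runs.Oracle[of A x] by (intro exI[of _ "{x}"]) auto
next
  case (Comp f gs)
  from Comp.prems obtain ys where ys: "length ys = length gs"
    "\<And>i. i < length gs \<Longrightarrow> approx (gs ! i) (A \<restriction> l) t xs = Suc (ys ! i)"
    "approx f (A \<restriction> l) t ys = Suc y" unfolding approx_Comp_iff by blast
  have "\<forall>i<length gs. \<exists>Q\<subseteq>{..<l}. runs A (gs ! i) xs (ys ! i) Q"
    using Comp.IH(2) ys(2) by simp
  then obtain Qs where Qs: "\<forall>i<length gs. Qs i \<subseteq> {..<l} \<and> runs A (gs ! i) xs (ys ! i) (Qs i)"
    by metis
  obtain Q where "Q \<subseteq> {..<l}" "runs A f ys y Q" using Comp.IH(1) ys(3) by blast
  then have "runs A (Comp f gs) xs y (Q \<union> (\<Union>i<length gs. Qs i))"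
    "Q \<union> (\<Union>i<length gs. Qs i) \<subseteq> {..<l}"
    using Qs ys(1) by (blast intro: runs.Comp)+
  then show ?case by blast
next
  case (PrimRec f g)
  then obtain n as where xs: "xs = n # as" by (cases xs) auto
  have "approx (PrimRec f g) (A \<restriction> l) t (n # as) = Suc y \<Longrightarrow>
      \<exists>Q\<subseteq>{..<l}. runs A (PrimRec f g) (n # as) y Q" for y
  proof (induction n arbitrary: y)
    case 0
    then show ?case using PrimRec.IH(1)[of as y] by (auto intro: runs.PrimRec_0)
  next
    case (Suc n)
    then obtain z where z: "approx (PrimRec f g) (A \<restriction> l) t (n # as) = Suc z"
      "approx g (A \<restriction> l) t (n # z # as) = Suc y"
      unfolding approx_PrimRec_Suc_iff by blast
    obtain Q where "Q \<subseteq> {..<l}" "runs A (PrimRec f g) (n # as) z Q" using Suc.IH[OF z(1)] by blast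
    moreover obtain Q' where "Q' \<subseteq> {..<l}" "runs A g (n # z # as) y Q'"
      using PrimRec.IH(2)[OF z(2)] by blast
    ultimately show ?case by (meson Un_least runs.PrimRec_Suc)
  qed
  then show ?case using PrimRec.prems xs by blast
next
  case (Mu f)
  then have n: "approx f (A \<restriction> l) t (y # xs) = Suc 0"
    and m: "\<And>m. m < y \<Longrightarrow> approx f (A \<restriction> l) t (m # xs) > 1"
    unfolding approx_Mu_iff by auto
  \<comment> \<open>The zero at \<open>y\<close> and the positive values before it are treated
    together, so that a single family of query sets can be chosen for
    \<open>runs.Mu\<close>.\<close>
  have "\<forall>m\<le>y. \<exists>v Q. Q \<subseteq> {..<l} \<and> runs A f (m # xs) v Q \<and> (if m = y then v = 0 else v > 0)"
  proof (intro allI impI)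
    fix m assume "m \<le> y"
    show "\<exists>v Q. Q \<subseteq> {..<l} \<and> runs A f (m # xs) v Q \<and> (if m = y then v = 0 else v > 0)"
    proof (cases "m = y")
      case True
      then show ?thesis using Mu.IH[OF n] by auto
    next
      case False
      then obtain v where "approx f (A \<restriction> l) t (m # xs) = Suc v" "v > 0"
        using m[of m] \<open>m \<le> y\<close> by (cases "approx f (A \<restriction> l) t (m # xs)") auto
      then show ?thesis using Mu.IH[of "m # xs" v] False by auto
    qed
  qed
  then obtain v Qs where Qs: "\<And>m. m \<le> y \<Longrightarrow> Qs m \<subseteq> {..<l} \<and> runs A f (m # xs) (v m) (Qs m) \<and>
      (if m = y then v m = 0 else v m > 0)" by metis
  then have "runs A (Mu f) xs y (\<Union>m\<le>y. Qs m)"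
    using Qs[of y] by (intro runs.Mu) (auto, metis less_imp_le_nat nat_neq_iff)
  moreover have "(\<Union>m\<le>y. Qs m) \<subseteq> {..<l}" using Qs by blast
  ultimately show ?case by blast
qed

text \<open>Every rule has finitely many premises, so their time bounds can be met simultaneously; a
  search with result \<open>n\<close> asks in addition for \<open>t > n\<close>. The known part of
  the oracle stays fixed.\<close>

lemma approx_complete:
  "runs A p xs y Q \<Longrightarrow> Q \<subseteq> {..<l} \<Longrightarrow> eventually (\<lambda>t. approx p (A \<restriction> l) t xs = Suc y) at_top"
proof (induction rule: runs.induct)
  case (Oracle x)
  then show ?case by (auto simp: query_def)
next
  case (Comp ys gs xs Qs f y Q)
  have "eventually (\<lambda>t. \<forall>i\<in>{..<length gs}. approx (gs ! i) (A \<restriction> l) t xs = Suc (ys ! i)) at_top"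
    using Comp by (intro eventually_ball_finite) auto
  moreover have "eventually (\<lambda>t. approx f (A \<restriction> l) t ys = Suc y) at_top"
    using Comp by auto
  ultimately show ?case
    unfolding approx_Comp_iff
    by eventually_elim (use Comp.hyps in auto)
next
  case (PrimRec_Suc f g n xs z Q y Q')
  then have "eventually (\<lambda>t. approx (PrimRec f g) (A \<restriction> l) t (n # xs) = Suc z) at_top"
    "eventually (\<lambda>t. approx g (A \<restriction> l) t (n # z # xs) = Suc y) at_top" by auto
  then show ?case by eventually_elim (use approx_PrimRec_Suc_iff in blast)
next
  case (Mu f n xs Qs)
  have "eventually (\<lambda>t. \<forall>m\<in>{..<n}. approx f (A \<restriction> l) t (m # xs) > 1) at_top"
  proof (intro eventually_ball_finite ballI)
    fix m assume "m \<in> {..<n}"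
    then obtain v where "v > 0" "eventually (\<lambda>t. approx f (A \<restriction> l) t (m # xs) = Suc v) at_top"
      using Mu by (metis UN_subset_iff atMost_iff lessThan_iff less_imp_le_nat)
    then show "eventually (\<lambda>t. approx f (A \<restriction> l) t (m # xs) > 1) at_top"
      by (auto elim: eventually_mono)
  qed simp
  moreover have "eventually (\<lambda>t. approx f (A \<restriction> l) t (n # xs) = Suc 0) at_top"
    using Mu by auto
  ultimately show ?case
    using eventually_gt_at_top[of n] unfolding approx_Mu_iff by eventually_elim auto
qed auto

text \<open>A defined result rests on answered queries and on searches that ended in time. Neither
  is disturbed by a longer string or a larger time bound.\<close>

lemma approx_mono:
  "approx p \<sigma> t xs = Suc y \<Longrightarrow> t \<le> t' \<Longrightarrow> approx p (\<sigma> @ \<tau>) t' xs = Suc y"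
proof (induction p arbitrary: xs y)
  case Oracle
  then show ?case by (auto simp: query_def nth_append split: if_splits)
next
  case (Comp f gs)
  then show ?case unfolding approx_Comp_iff by (metis nth_mem)
next
  case (PrimRec f g)
  then obtain n as where xs: "xs = n # as" by (cases xs) auto
  have "approx (PrimRec f g) \<sigma> t (n # as) = Suc y \<Longrightarrow>
      approx (PrimRec f g) (\<sigma> @ \<tau>) t' (n # as) = Suc y" for y
  proof (induction n arbitrary: y)
    case 0
    then show ?case using PrimRec.IH(1) PrimRec.prems(2) by simp
  next
    case (Suc n)
    then obtain z where "approx (PrimRec f g) \<sigma> t (n # as) = Suc z"
      "approx g \<sigma> t (n # z # as) = Suc y"
      unfolding approx_PrimRec_Suc_iff by blast
    then show ?case
      using Suc.IH PrimRec.IH(2) PrimRec.prems(2) unfolding approx_PrimRec_Suc_iff by blast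
  qed
  then show ?case using PrimRec.prems xs by blast
next
  case (Mu f)
  \<comment> \<open>Both the final zero and the earlier positive values are defined, so the
    induction hypothesis preserves all of them and with them the outcome of the search.\<close>
  have "approx f (\<sigma> @ \<tau>) t' (m # xs) = approx f \<sigma> t (m # xs)" if "approx f \<sigma> t (m # xs) > 0" for m
    using Mu.IH[of "m # xs"] Mu.prems(2) that by (metis gr0_conv_Suc)
  then show ?case using Mu.prems unfolding approx_Mu_iff
    by (metis One_nat_def less_le_trans less_trans zero_less_one)
qed (auto split: if_splits)

text \<open>The program is fixed while string and time bound are arguments, and every clause of
  \<open>approx\<close> is total. The induction treats all \<open>k\<close> at once because
  subprograms take other numbers of arguments.\<close>

lemma computable_approx:
  "computable A (Suc (Suc k)) (\<lambda>zs. approx p (str_of (zs ! 0)) (zs ! 1) (drop 2 zs))"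
proof (induction p arbitrary: k)
  case Zero
  then show ?case by (simp add: computable_const)
next
  case Succ
  have "computable A (Suc (Suc k)) (\<lambda>zs. if k = 1 then Suc (Suc (drop 2 zs ! 0)) else 0)"
    by (cases "k = 1") (auto intro!: computable_intros)
  then show ?case by (subst computable_cong) auto
next
  case (Proj i)
  have "computable A (Suc (Suc k)) (\<lambda>zs. if i < k then Suc (drop 2 zs ! i) else 0)"
    by (cases "i < k") (auto intro!: computable_intros)
  then show ?case by (subst computable_cong) auto
next
  case Oracle
  have "computable A (Suc (Suc k)) (\<lambda>zs. if k = 1 then query (str_of (zs ! 0)) (drop 2 zs ! 0) else 0)"
    by (cases "k = 1") (auto intro!: computable_intros computable_query)
  then show ?case by (subst computable_cong) auto
next
  case (Comp f gs)
  have 1: "decidable A (Suc (Suc k)) (\<lambda>zs. \<exists>g\<in>set hs. approx g (str_of (zs ! 0)) (zs ! 1) (drop 2 zs) = 0)"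
    if "set hs \<subseteq> set gs" for hs using that
  proof (induction hs)
    case Nil
    then show ?case by (simp add: decidable_def computable_const)
  next
    case (Cons h hs)
    then show ?case using Comp.IH(2)[of h k] by (auto intro!: computable_intros)
  qed
  let ?hs = "(\<lambda>zs. zs ! 0) # (\<lambda>zs. zs ! 1) #
    map (\<lambda>g zs. approx g (str_of (zs ! 0)) (zs ! 1) (drop 2 zs) - 1) gs"
  have "computable A (Suc (Suc k)) (\<lambda>zs. (\<lambda>ys. approx f (str_of (ys ! 0)) (ys ! 1) (drop 2 ys))
      (map (\<lambda>h. h zs) ?hs))"
    using Comp.IH by (intro computable_comp[where n = "Suc (Suc (length gs))"])
      (auto intro!: computable_intros)
  then have "computable A (Suc (Suc k)) (\<lambda>zs. approx f (str_of (zs ! 0)) (zs ! 1)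
      (map (\<lambda>g. approx g (str_of (zs ! 0)) (zs ! 1) (drop 2 zs) - 1) gs))"
    by (simp add: comp_def)
  then show ?case using 1[of gs] by (auto intro!: computable_intros)
next
  case (PrimRec f g)
  show ?case
  proof (cases k)
    case 0
    then show ?thesis
      by (subst computable_cong[where G = "\<lambda>_. 0"]) (auto simp: computable_const)
  next
    case (Suc j)
    \<comment> \<open>The string, the time bound, and the arguments without the recursion argument,
      which stands at position 2.\<close>
    let ?hf = "(\<lambda>zs. zs ! 0) # (\<lambda>zs. zs ! 1) # map (\<lambda>i zs. zs ! i) [3..<Suc (Suc k)]"
    have "computable A (Suc (Suc k)) (\<lambda>zs. (\<lambda>ys. approx f (str_of (ys ! 0)) (ys ! 1) (drop 2 ys))
        (map (\<lambda>h. h zs) ?hf))"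
      using Suc PrimRec.IH(1)[of j]
      by (intro computable_comp[where n = "Suc (Suc j)"]) (auto intro!: computable_intros)
    moreover have "map ((!) zs) [3..<Suc (Suc k)] = drop 3 zs" if "length zs = Suc (Suc k)"
      for zs :: "nat list"
      using that by (rule map_nth_upt_eq_drop)
    ultimately have F: "computable A (Suc (Suc k))
        (\<lambda>zs. approx f (str_of (zs ! 0)) (zs ! 1) (drop 3 zs))"
      by (subst computable_cong) (auto simp: comp_def simp del: upt_Suc)
    \<comment> \<open>In the recursion step the counter and the coded previous value come first,
      then the string, the time bound, the recursion argument (skipped, position 4) and the
      parameters.\<close>
    let ?hg = "(\<lambda>zs. zs ! 2) # (\<lambda>zs. zs ! 3) # (\<lambda>zs. zs ! 0) # (\<lambda>zs. zs ! 1 - 1) #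
      map (\<lambda>i zs. zs ! i) [5..<k + 4]"
    have "computable A (k + 4) (\<lambda>zs. (\<lambda>ys. approx g (str_of (ys ! 0)) (ys ! 1) (drop 2 ys))
        (map (\<lambda>h. h zs) ?hg))"
      using Suc PrimRec.IH(2)[of "Suc k"]
      by (intro computable_comp[where n = "k + 3"]) (auto intro!: computable_intros simp: eval_nat_numeral)
    moreover have "map ((!) zs) [5..<k + 4] = drop 5 zs" if "length zs = k + 4" for zs :: "nat list"
      using that by (rule map_nth_upt_eq_drop)
    ultimately have G: "computable A (k + 4)
        (\<lambda>zs. approx g (str_of (zs ! 2)) (zs ! 3) (zs ! 0 # (zs ! 1 - 1) # drop 5 zs))"
      by (subst computable_cong) (auto simp: comp_def simp del: upt_Suc)
    have G': "computable A (Suc (Suc (Suc (Suc k)))) (\<lambda>ys. if ys ! 1 = 0 then 0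
       else approx g (str_of (drop 2 ys ! 0)) (drop 2 ys ! 1)
         (ys ! 0 # (ys ! 1 - 1) # drop 3 (drop 2 ys)))"
    proof (intro computable_if decidable_eq computable_nth computable_const)
      show "computable A (Suc (Suc (Suc (Suc k)))) (\<lambda>ys. approx g (str_of (drop 2 ys ! 0)) (drop 2 ys ! 1)
         (ys ! 0 # (ys ! 1 - 1) # drop 3 (drop 2 ys)))"
        using G by (subst computable_cong[where G =
              "\<lambda>zs. approx g (str_of (zs ! 2)) (zs ! 3) (zs ! 0 # (zs ! 1 - 1) # drop 5 zs)"])
          (simp_all add: numeral_eq_Suc)
    qed auto
    have "computable A (Suc (Suc k)) (\<lambda>zs. rec_nat (approx f (str_of (zs ! 0)) (zs ! 1) (drop 3 zs))
        (\<lambda>m z. if z = 0 then 0 else approx g (str_of (zs ! 0)) (zs ! 1) (m # (z - 1) # drop 3 zs))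
        (zs ! 2))"
      using Suc by (intro computable_rec F G' computable_nth) auto
    moreover have "approx (PrimRec f g) (str_of (zs ! 0)) (zs ! 1) (drop 2 zs) =
        rec_nat (approx f (str_of (zs ! 0)) (zs ! 1) (drop 3 zs))
        (\<lambda>m z. if z = 0 then 0 else approx g (str_of (zs ! 0)) (zs ! 1) (m # (z - 1) # drop 3 zs))
        (zs ! 2)" if "length zs = Suc (Suc k)" for zs
    proof -
      have "drop 2 zs = zs ! 2 # drop 3 zs"
        using that Suc Cons_nth_drop_Suc[of 2 zs] by (simp add: numeral_2_eq_2 numeral_3_eq_3)
      then show ?thesis unfolding approx.simps by (simp only: list.sel list.distinct if_False)
    qed
    ultimately show ?thesis by (subst computable_cong)
  qed
next
  case (Mu f)
  \<comment> \<open>Here the search variable comes first, followed by the string, the time bound and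
    the arguments of the search.\<close>
  let ?hs = "(\<lambda>zs. zs ! 1) # (\<lambda>zs. zs ! 2) # (\<lambda>zs. zs ! 0) # map (\<lambda>i zs. zs ! i) [3..<k + 3]"
  have "computable A (k + 3) (\<lambda>zs. (\<lambda>ys. approx f (str_of (ys ! 0)) (ys ! 1) (drop 2 ys))
      (map (\<lambda>h. h zs) ?hs))"
    using Mu.IH[of "Suc k"] by (intro computable_comp[where n = "k + 3"])
      (auto intro!: computable_intros simp: eval_nat_numeral)
  moreover have "map ((!) zs) [3..<k + 3] = drop 3 zs" if "length zs = k + 3" for zs :: "nat list"
    using that by (rule map_nth_upt_eq_drop)
  ultimately have F: "computable A (k + 3)
      (\<lambda>zs. approx f (str_of (zs ! 1)) (zs ! 2) (zs ! 0 # drop 3 zs))"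
    by (subst computable_cong) (auto simp: comp_def)
  have F': "computable A (Suc (Suc (Suc k)))
      (\<lambda>zs. approx f (str_of (drop 1 zs ! 0)) (drop 1 zs ! 1) (zs ! 0 # drop 2 (drop 1 zs)))"
    using F by (subst computable_cong[where G =
          "\<lambda>zs. approx f (str_of (zs ! 1)) (zs ! 2) (zs ! 0 # drop 3 zs)"])
      (simp_all add: numeral_eq_Suc)
  let ?N = "\<lambda>zs. LEAST n. n = zs ! 1 \<or> approx f (str_of (zs ! 0)) (zs ! 1) (n # drop 2 zs) \<le> 1"
  have N: "computable A (Suc (Suc k)) ?N"
    by (intro computable_Least decidable_disj decidable_le F' computable_intros) auto
  have "computable A (Suc (Suc k)) (\<lambda>zs. (\<lambda>ys. approx f (str_of (ys ! 1)) (ys ! 2) (ys ! 0 # drop 3 ys))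
      (map (\<lambda>h. h zs) (?N # map (\<lambda>i zs. zs ! i) [0..<Suc (Suc k)])))"
    using N by (intro computable_comp[OF F]) (auto intro!: computable_intros simp del: upt_Suc)
  moreover have "map ((!) zs) [0..<Suc (Suc k)] = zs" if "length zs = Suc (Suc k)" for zs :: "nat list"
    using that map_nth by metis
  ultimately have "computable A (Suc (Suc k))
      (\<lambda>zs. approx f (str_of (zs ! 0)) (zs ! 1) (?N zs # drop 2 zs))"
    by (subst computable_cong) (auto simp: comp_def numeral_eq_Suc simp del: upt_Suc)
  then show ?case unfolding approx.simps Let_def
    by (intro computable_intros N) auto
qed

lemma computable_approx_singleton:
  assumes "computable A k C" "computable A k T" "computable A k X"
  shows "computable A k (\<lambda>zs. approx p (str_of (C zs)) (T zs) [X zs])"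
proof -
  have "computable A k (\<lambda>zs. (\<lambda>ys. approx p (str_of (ys ! 0)) (ys ! 1) (drop 2 ys))
      (map (\<lambda>g. g zs) [C, T, X]))"
    using assms by (intro computable_comp[OF computable_approx[of A 1]]) auto
  then show ?thesis by simp
qed

section \<open>Use bounds\<close>

text \<open>Weak Koenig's lemma for the binary tree of bad strings. The path runs through nodes that
  have bad extensions by every length.\<close>

lemma koenig:
  assumes prefix: "\<And>\<sigma> \<tau>. bad (\<sigma> @ \<tau>) \<Longrightarrow> bad \<sigma>"
    and long: "\<And>n. \<exists>\<sigma>. length \<sigma> = n \<and> bad \<sigma>"
  shows "\<exists>X. \<forall>n. bad (X \<restriction> n)"
proof -
  define tall where "tall \<sigma> \<longleftrightarrow> (\<forall>n. \<exists>\<tau>. length \<tau> = n \<and> bad (\<sigma> @ \<tau>))" for \<sigma>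
  have step: "tall (\<sigma> @ [True]) \<or> tall (\<sigma> @ [False])" if \<sigma>: "tall \<sigma>" for \<sigma>
  proof (rule ccontr)
    assume "\<not> ?thesis"
    then have "\<not> tall (\<sigma> @ [b])" for b by (cases b) auto
    then have "\<exists>n. \<forall>\<tau>. length \<tau> = n \<longrightarrow> \<not> bad (\<sigma> @ [b] @ \<tau>)" for b by (simp add: tall_def)
    then obtain n where n: "\<And>b \<tau>. length \<tau> = n b \<Longrightarrow> \<not> bad (\<sigma> @ [b] @ \<tau>)"
      by metis
    \<comment> \<open>Whichever child \<tau> passes through, it goes on for at least as long as bad
      extensions of that child are excluded.\<close>
    obtain \<tau> where \<tau>: "length \<tau> = Suc (max (n True) (n False))" "bad (\<sigma> @ \<tau>)"
      using \<sigma> unfolding tall_def by blast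
    then obtain b \<tau>' where b: "\<tau> = b # \<tau>'" by (cases \<tau>) auto
    then have "n b \<le> length \<tau>'" using \<tau>(1) by (cases b) auto
    moreover have "bad (\<sigma> @ [b] @ take (n b) \<tau>')"
      using prefix[of "\<sigma> @ [b] @ take (n b) \<tau>'" "drop (n b) \<tau>'"] \<tau>(2) b by simp
    ultimately show False using n[of "take (n b) \<tau>'" b] by simp
  qed
  \<comment> \<open>Go to the child \<open>True\<close> if it is tall; otherwise the child
    \<open>False\<close> is tall.\<close>
  define S where "S = rec_nat [] (\<lambda>m \<sigma>. \<sigma> @ [tall (\<sigma> @ [True])])"
  define X where "X = {n. tall (S n @ [True])}"
  have S: "X \<restriction> n = S n" for n
    by (induction n) (auto simp: S_def X_def prefix_of_Suc)
  have "tall (S n)" for n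
  proof (induction n)
    case 0
    then show ?case using long by (simp add: S_def tall_def)
  next
    case (Suc n)
    then show ?case using step[OF Suc] by (cases "tall (S n @ [True])") (auto simp: S_def)
  qed
  then have "bad (S n)" for n unfolding tall_def by (metis append_Nil2 length_0_conv)
  then show ?thesis using S by metis
qed

lemma prefix_of_extend:
  assumes "l \<le> t"
  shows "\<exists>\<tau>. A \<restriction> t = A \<restriction> l @ \<tau>"
proof -
  have "[0..<t] = [0..<l] @ [l..<t]" using assms upt_add_eq_append[of 0 l "t - l"] by simp
  then show ?thesis by (simp add: prefix_of_def)
qed

text \<open>By monotonicity one number can serve as length of the known prefix and as time bound, so
  a single search finds both.\<close>

lemma approx_prefix:
  assumes "runs A p xs y Q"
  shows "\<exists>t. approx p (A \<restriction> t) t xs = Suc y"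
proof -
  obtain l where l: "Q \<subseteq> {..<l}"
    using runs_finite[OF assms] unfolding finite_nat_set_iff_bounded by blast
  have "eventually (\<lambda>t. approx p (A \<restriction> l) t xs = Suc y \<and> l \<le> t) at_top"
    using approx_complete[OF assms l] eventually_ge_at_top by (rule eventually_conj)
  then obtain t where t: "approx p (A \<restriction> l) t xs = Suc y" "l \<le> t"
    using eventually_happens'[OF trivial_limit_at_top_linorder] by blast
  obtain \<tau> where "A \<restriction> t = A \<restriction> l @ \<tau>" using prefix_of_extend[OF t(2)] by blast
  then show ?thesis using approx_mono[OF t(1) order_refl, of \<tau>] by (intro exI[of _ t]) simp
qed

text \<open>By determinism a defined approximation has the right value, so its mere convergence
  certifies the use bound \<open>l\<close>.\<close>

lemma approx_value:
  assumes "approx p (A \<restriction> l) t xs \<noteq> 0" "\<exists>Q. runs A p xs y Q"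
  shows "\<exists>Q\<subseteq>{..<l}. runs A p xs y Q"
proof -
  obtain z where z: "approx p (A \<restriction> l) t xs = Suc z" using assms(1) not0_implies_Suc by blast
  from approx_sound[OF this] obtain Q where Q: "Q \<subseteq> {..<l}" "runs A p xs z Q" by blast
  moreover obtain R where "runs A p xs y R" using assms(2) by blast
  ultimately have "z = y" using runs_deterministic by blast
  then show ?thesis using Q by blast
qed

text \<open>With oracle \<open>A\<close> one can search for the first prefix of \<open>A\<close> on
  which the approximation converges.\<close>

lemma turing_use_bound:
  assumes "\<And>x. \<exists>Q. runs A p [x] (f x) Q"
  shows "\<exists>h. h \<le>T A \<and> (\<forall>x. \<exists>Q\<subseteq>{..<h x}. runs A p [x] (f x) Q)"
proof -
  define h where "h x = (LEAST t. approx p (A \<restriction> t) t [x] \<noteq> 0)" for x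
  have ex: "\<exists>t. approx p (A \<restriction> t) t [x] \<noteq> 0" for x
    using assms[of x] approx_prefix by (metis nat.distinct(1))
  have "approx p (A \<restriction> h x) (h x) [x] \<noteq> 0" for x
    unfolding h_def by (rule LeastI_ex[OF ex])
  then have "\<exists>Q\<subseteq>{..<h x}. runs A p [x] (f x) Q" for x
    using assms by (rule approx_value)
  moreover have "computable A 1 (\<lambda>xs. LEAST t. approx p (str_of (str_code (A \<restriction> t))) t [xs ! 0] \<noteq> 0)"
    using ex by (intro computable_Least decidable_not decidable_eq computable_approx_singleton
        computable_prefix computable_const computable_nth computable_nth_drop) auto
  then have "h \<le>T A" by (simp add: turing_le_iff_computable h_def)
  ultimately show ?thesis by blast
qed

lemma computable_power2:
  assumes "computable A k F"
  shows "computable A k (\<lambda>xs. 2 ^ F xs)"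
proof -
  have "rec_nat 1 (\<lambda>m z. z + z) y = (2 ^ y :: nat)" for y
    by (induction y) auto
  moreover have "computable A k (\<lambda>xs. rec_nat 1 (\<lambda>m z. z + z) (F xs))"
    using assms by (intro computable_rec computable_add computable_const computable_nth) auto
  ultimately show ?thesis by simp
qed

text \<open>Strings on which \<open>p\<close> has not yet converged form a tree. An infinite path
  would be an oracle on which \<open>p\<close> diverges, so some level has no such string, and it
  can be found without consulting \<open>A\<close>.\<close>

lemma wtt_le_if_tt_le:
  assumes "f \<le>tt A"
  shows "f \<le>wtt A"
proof -
  obtain p where total: "\<And>X x. \<exists>y Q. runs X p [x] y Q"
    and p: "\<And>x. \<exists>Q. runs A p [x] (f x) Q"
    using assms unfolding tt_le_def by blast
  \<comment> \<open>All strings of length \<open>l\<close> have codes below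
    \<open>2 ^ Suc l\<close>, so the quantifier over strings is bounded and the condition
    decidable.\<close>
  define good where "good l x \<longleftrightarrow>
    (\<forall>c<2 ^ Suc l. length (str_of c) \<noteq> l \<or> approx p (str_of c) l [x] \<noteq> 0)" for l x
  have ex: "\<exists>l. good l x" for x
  proof (rule ccontr)
    assume "\<not> ?thesis"
    then have long: "\<exists>\<sigma>. length \<sigma> = l \<and> approx p \<sigma> (length \<sigma>) [x] = 0" for l
    proof -
      have "\<not> good l x" using \<open>\<not> (\<exists>l. good l x)\<close> by simp
      then obtain c where "length (str_of c) = l" "approx p (str_of c) l [x] = 0"
        unfolding good_def by blast
      then show ?thesis by (intro exI[of _ "str_of c"]) simp
    qed
    have prefix: "approx p \<sigma> (length \<sigma>) [x] = 0" if "approx p (\<sigma> @ \<tau>) (length (\<sigma> @ \<tau>)) [x] = 0" for \<sigma> \<tau>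
    proof (rule ccontr)
      assume "\<not> ?thesis"
      then obtain y where "approx p \<sigma> (length \<sigma>) [x] = Suc y" using not0_implies_Suc by blast
      from approx_mono[OF this, of "length (\<sigma> @ \<tau>)" \<tau>] that show False by simp
    qed
    have "\<exists>X. \<forall>n. approx p (X \<restriction> n) (length (X \<restriction> n)) [x] = 0"
      using prefix long by (rule koenig[of "\<lambda>\<sigma>. approx p \<sigma> (length \<sigma>) [x] = 0"])
    then obtain X where X: "\<And>n. approx p (X \<restriction> n) n [x] = 0" by auto
    obtain y Q where "runs X p [x] y Q" using total by blast
    from approx_prefix[OF this] X show False by simp
  qed
  define h where "h x = (LEAST l. good l x)" for x
  have "computable {} 1 (\<lambda>xs. LEAST l. good l (xs ! 0))"
    unfolding good_def
  proof (intro computable_Least decidable_all_less decidable_disj decidable_not decidable_eq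
      computable_approx_singleton computable_length computable_power2)
    show "\<exists>l. \<forall>c<2 ^ Suc l. length (str_of c) \<noteq> l \<or> approx p (str_of c) l [xs ! 0] \<noteq> 0" for xs
      using ex[of "xs ! 0"] unfolding good_def .
  qed (auto intro!: computable_intros simp: drop_drop)
  then have "recursive h" unfolding recursive_iff_computable h_def .
  moreover have "\<exists>Q. runs A p [x] (f x) Q \<and> (\<forall>q\<in>Q. q < h x)" for x
  proof -
    have "good (h x) x" unfolding h_def by (rule LeastI_ex[OF ex])
    moreover have "str_code (A \<restriction> h x) < 2 ^ Suc (h x)" using str_code_less[of "A \<restriction> h x"] by simp
    ultimately have "approx p (A \<restriction> h x) (h x) [x] \<noteq> 0"
      unfolding good_def by (auto dest!: spec[of _ "str_code (A \<restriction> h x)"])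
    from approx_value[OF this p] show ?thesis by blast
  qed
  ultimately show ?thesis unfolding wtt_le_def by blast
qed

section \<open>Complexity and diagonalization\<close>

text \<open>Optimality is applied to the identity machine.\<close>

lemma universal_machine_surj:
  assumes "universal_machine U"
  shows "\<exists>\<tau>. U \<tau> = Some \<sigma>"
proof -
  have "(\<exists>Q. runs {} (Proj 0) xs y Q) \<longleftrightarrow> xs ! 0 = y" if "length xs = 1" for xs y
    using that runs.Proj[of 0 xs "{}"] by (auto elim: runs_ProjE)
  then have "partial_recursive1 Some"
    unfolding partial_recursive1_def partial_recursive_def
    by (intro exI[of _ "Proj 0"]) simp
  then have "machine Some" unfolding machine_def by (intro exI[of _ Some]) auto
  then show ?thesis using assms unfolding universal_machine_def by blast
qed

lemma plain_complexity_attained: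
  assumes "universal_machine U"
  shows "\<exists>\<tau>. U \<tau> = Some \<sigma> \<and> length \<tau> = plain_complexity U \<sigma>"
  unfolding plain_complexity_def
  by (rule LeastI_ex) (use universal_machine_surj[OF assms] in blast)

lemma plain_complexity_le: "U \<tau> = Some \<sigma> \<Longrightarrow> plain_complexity U \<sigma> \<le> length \<tau>"
  unfolding plain_complexity_def by (blast intro: Least_le)

text \<open>Descriptions shorter than \<open>n\<close> have codes below \<open>2 ^ n\<close>, so a
  prefix longer than all values of \<open>v\<close> on these codes has complexity at least
  \<open>n\<close>. Inverting this length bound gives the order function. Here \<open>B\<close> will
  be \<open>A\<close> or the empty set.\<close>

lemma order_function_of_bound:
  assumes U: "universal_machine U"
    and v: "computable B 1 (\<lambda>xs. v (xs ! 0))"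
    and bound: "\<And>\<tau> y. U \<tau> = Some (A \<restriction> y) \<Longrightarrow> y < v (str_code \<tau>)"
  shows "\<exists>g. g \<le>T B \<and> mono g \<and> (\<forall>n. \<exists>y. n \<le> g y) \<and> (\<forall>y. g y \<le> plain_complexity U (A \<restriction> y))"
proof -
  \<comment> \<open>A running sum dominates all earlier values of \<open>v\<close>; the successor
    makes it unbounded even if \<open>v\<close> vanishes.\<close>
  define w where "w n = rec_nat 0 (\<lambda>m z. Suc (z + v m)) n" for n
  have w_mono: "mono w" by (rule mono_iff_le_Suc[THEN iffD2]) (simp add: w_def)
  have w_ge: "n \<le> w n" for n by (induction n) (auto simp: w_def)
  have w_greater: "v k < w n" if "k < n" for k n
    using that monoD[OF w_mono, of "Suc k" n] by (simp add: w_def)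
  define W where "W n = w (2 ^ n)" for n
  have W_mono: "m \<le> n \<Longrightarrow> W m \<le> W n" for m n
    unfolding W_def by (intro monoD[OF w_mono] power_increasing) auto
  have W_ge: "n < W n" for n
    using w_ge[of "2 ^ n"] less_exp[of n] unfolding W_def by linarith
  \<comment> \<open>The largest \<open>n\<close> with \<open>W n \<le> y\<close>, or 0 if there is
    none.\<close>
  define g where "g y = (LEAST n. y < W (Suc n))" for y
  have ex: "\<exists>n. y < W (Suc n)" for y using W_ge[of "Suc y"] by (intro exI[of _ y]) simp
  have g_less: "y < W (Suc (g y))" for y
    unfolding g_def using ex[of y] by (rule LeastI_ex[where P = "\<lambda>n. y < W (Suc n)"])
  have g_le: "W (g y) \<le> y" if nz: "g y \<noteq> 0" for y
  proof -
    obtain n where n: "g y = Suc n" using nz not0_implies_Suc by blast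
    then have "\<not> y < W (Suc n)" using not_less_Least[of n "\<lambda>n. y < W (Suc n)"] by (simp add: g_def)
    then show ?thesis by (simp add: n)
  qed
  have "mono g"
  proof (rule monoI)
    fix x y :: nat assume "x \<le> y"
    then show "g x \<le> g y" using g_less[of y] unfolding g_def[of x] by (intro Least_le) simp
  qed
  moreover have unbounded: "n \<le> g (W n)" for n
  proof (rule ccontr)
    assume "\<not> n \<le> g (W n)"
    then have "W (Suc (g (W n))) \<le> W n" by (intro W_mono) simp
    then show False using g_less[of "W n"] by simp
  qed
  moreover have "g y \<le> plain_complexity U (A \<restriction> y)" for y
  proof (rule ccontr)
    assume less: "\<not> ?thesis"
    obtain \<tau> where \<tau>: "U \<tau> = Some (A \<restriction> y)" "length \<tau> = plain_complexity U (A \<restriction> y)"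
      using plain_complexity_attained[OF U] by blast
    then have "Suc (length \<tau>) \<le> g y" using less by simp
    \<comment> \<open>A description shorter than \<open>g y\<close> is among the codes that
      \<open>W (g y)\<close> takes into account.\<close>
    then have "(2::nat) ^ Suc (length \<tau>) \<le> 2 ^ g y" by (intro power_increasing) auto
    then have "str_code \<tau> < 2 ^ g y" using str_code_less[of \<tau>] by linarith
    then have "v (str_code \<tau>) < W (g y)" unfolding W_def by (rule w_greater)
    then show False using g_le[of y] bound[OF \<tau>(1)] less by simp
  qed
  moreover have "g \<le>T B"
  proof -
    have W: "computable B 1 (\<lambda>xs. W (xs ! 0))"
      unfolding W_def w_def
      by (intro computable_rec computable_app1[OF v] computable_power2 computable_Suc computable_add
          computable_nth computable_const) auto
    have "computable B 1 (\<lambda>xs. LEAST n. xs ! 0 < W (Suc n))"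
      by (intro computable_Least ex decidable_less computable_app1[OF W] computable_Suc
          computable_nth computable_nth_drop) auto
    then show ?thesis unfolding turing_le_iff_computable g_def .
  qed
  ultimately show ?thesis by meson
qed

section \<open>Halting computations of programs that need not be total\<close>

lemma ex_runs_Comp1:
  assumes "\<exists>Q. runs A g xs z Q" "\<exists>Q. runs A f [z] y Q"
  shows "\<exists>Q. runs A (Comp f [g]) xs y Q"
proof -
  obtain Q R where "runs A g xs z Q" "runs A f [z] y R" using assms by blast
  then show ?thesis using runs.Comp[of "[z]" "[g]" A xs "\<lambda>_. Q" f y R] by auto
qed

lemma ex_runs_Comp2:
  assumes "\<exists>Q. runs A g xs z Q" "\<exists>Q. runs A g' xs z' Q" "\<exists>Q. runs A f [z, z'] y Q"
  shows "\<exists>Q. runs A (Comp f [g, g']) xs y Q"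
proof -
  obtain Q Q' R where "runs A g xs z Q" "runs A g' xs z' Q'" "runs A f [z, z'] y R"
    using assms by blast
  then show ?thesis
    using runs.Comp[of "[z, z']" "[g, g']" A xs "\<lambda>i. if i = 0 then Q else Q'" f y R]
    by (auto simp: less_Suc_eq)
qed

lemma ex_runs_Comp3:
  assumes "\<exists>Q. runs A g xs z Q" "\<exists>Q. runs A g' xs z' Q" "\<exists>Q. runs A g'' xs z'' Q"
    "\<exists>Q. runs A f [z, z', z''] y Q"
  shows "\<exists>Q. runs A (Comp f [g, g', g'']) xs y Q"
proof -
  obtain Q Q' Q'' R where "runs A g xs z Q" "runs A g' xs z' Q'" "runs A g'' xs z'' Q''"
    "runs A f [z, z', z''] y R"
    using assms by blast
  then show ?thesis
    using runs.Comp[of "[z, z', z'']" "[g, g', g'']" A xs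
        "\<lambda>i. if i = 0 then Q else if i = 1 then Q' else Q''" f y R]
    by (auto simp: less_Suc_eq)
qed

lemma ex_runs_Mu:
  assumes "\<exists>Q. runs A f (n # xs) 0 Q" "\<And>m. m < n \<Longrightarrow> \<exists>v Q. v > 0 \<and> runs A f (m # xs) v Q"
  shows "\<exists>Q. runs A (Mu f) xs n Q"
proof -
  obtain Q where Q: "runs A f (n # xs) 0 Q" using assms(1) by blast
  obtain v Qs where Qs: "\<And>m. m < n \<Longrightarrow> v m > 0 \<and> runs A f (m # xs) (v m) (Qs m)"
    using assms(2) by metis
  have "runs A (Mu f) xs n (\<Union>m\<le>n. (Qs(n := Q)) m)"
    using Q Qs by (intro runs.Mu) auto
  then show ?thesis by blast
qed

text \<open>The function is that of \<open>erase p\<close>, whose domain may be larger than that of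
  \<open>p\<close>; hence an implication only.\<close>

lemma partial_recursive2_of_program:
  "\<exists>\<psi>. partial_recursive2 \<psi> \<and> (\<forall>k x y Q. runs {} p [k, x] y Q \<longrightarrow> \<psi> k x = Some y)"
proof -
  define \<psi> where "\<psi> k x = (if \<exists>y Q. runs {} (erase p) [k, x] y Q
    then Some (THE y. \<exists>Q. runs {} (erase p) [k, x] y Q) else None)" for k x
  have \<psi>: "\<psi> k x = Some y \<longleftrightarrow> (\<exists>Q. runs {} (erase p) [k, x] y Q)" for k x y
  proof (cases "\<exists>y Q. runs {} (erase p) [k, x] y Q")
    case True
    then obtain z Q where z: "runs {} (erase p) [k, x] z Q" by blast
    then have "(THE y. \<exists>Q. runs {} (erase p) [k, x] y Q) = z"
      by (intro the_equality) (auto dest: runs_deterministic)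
    then have "\<psi> k x = Some z" using True by (simp add: \<psi>_def)
    then show ?thesis using z by (auto dest: runs_deterministic)
  next
    case False
    then show ?thesis by (auto simp: \<psi>_def)
  qed
  have "partial_recursive2 \<psi>"
    unfolding partial_recursive2_def partial_recursive_def
  proof (intro exI[of _ "erase p"] conjI allI impI oracle_free_erase)
    fix xs :: "nat list" and y assume "length xs = 2"
    then obtain k x where "xs = [k, x]" by (auto simp: numeral_2_eq_2 length_Suc_conv)
    then show "\<psi> (xs ! 0) (xs ! 1) = Some y \<longleftrightarrow> (\<exists>Q. runs {} (erase p) xs y Q)"
      using \<psi> by simp
  qed
  then show ?thesis using \<psi> runs_erase by blast
qed

text \<open>On input \<open>k\<close> and \<open>x\<close>, run \<open>U\<close> on the string coded
  by \<open>k\<close>, then search for a time at which \<open>p\<close> converges on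
  \<open>x\<close> with the resulting string as oracle. The set \<open>A\<close> enters only through
  its described prefix, so \<psi> is uniform in \<open>A\<close>.\<close>

lemma partial_recursive2_described_oracle:
  assumes "machine U"
  shows "\<exists>\<psi>. partial_recursive2 \<psi> \<and> (\<forall>\<tau> A y x v Q. U \<tau> = Some (A \<restriction> y) \<longrightarrow>
    runs A p [x] v Q \<longrightarrow> Q \<subseteq> {..<y} \<longrightarrow> \<psi> (str_code \<tau>) x = Some v)"
proof -
  obtain m where "partial_recursive1 m"
    and m: "\<And>\<sigma>. m (str_code \<sigma>) = map_option str_code (U \<sigma>)"
    using assms unfolding machine_def by blast
  then obtain pm where "\<forall>xs y. length xs = 1 \<longrightarrow> m (xs ! 0) = Some y \<longleftrightarrow> (\<exists>Q. runs {} pm xs y Q)"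
    unfolding partial_recursive1_def partial_recursive_def by blast
  then have pm: "\<exists>Q. runs {} pm [c] y Q" if "m c = Some y" for c y
    using that by (metis One_nat_def length_Cons list.size(3) nth_Cons_0)
  \<comment> \<open>Zero exactly if the approximation is defined at time \<open>t\<close>, as suits
    a search by \<open>Mu\<close>.\<close>
  have "computable {} 3 (\<lambda>xs. 1 - approx p (str_of (xs ! 1)) (xs ! 0) [xs ! 2])"
    by (intro computable_diff computable_approx_singleton computable_nth computable_const) auto
  then obtain pe where "\<And>xs. length xs = 3 \<Longrightarrow>
      \<exists>Q. runs {} pe xs (1 - approx p (str_of (xs ! 1)) (xs ! 0) [xs ! 2]) Q"
    unfolding computable_def by blast
  from this[of "[_, _, _]"]
  have pe: "\<exists>Q. runs {} pe [t, c, x] (1 - approx p (str_of c) t [x]) Q" for t c x by simp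
  have "computable {} 3 (\<lambda>xs. approx p (str_of (xs ! 1)) (xs ! 0) [xs ! 2] - 1)"
    by (intro computable_pred computable_approx_singleton computable_nth) auto
  then obtain pv where "\<And>xs. length xs = 3 \<Longrightarrow>
      \<exists>Q. runs {} pv xs (approx p (str_of (xs ! 1)) (xs ! 0) [xs ! 2] - 1) Q"
    unfolding computable_def by blast
  from this[of "[_, _, _]"]
  have pv: "\<exists>Q. runs {} pv [t, c, x] (approx p (str_of c) t [x] - 1) Q" for t c x by simp
  \<comment> \<open>The right argument list replaces the description by the code of its output. The
    inner program then finds the time and reads off the value there.\<close>
  define q where "q = Comp (Comp pv [Mu pe, Proj 0, Proj 1]) [Comp pm [Proj 0], Proj 1]"
  have proj: "\<exists>Q. runs {} (Proj i) xs y Q" if "i < length xs" "y = xs ! i" for i xs y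
    using that runs.Proj by blast
  have q: "\<exists>R. runs {} q [str_code \<tau>, x] v R"
    if \<tau>: "U \<tau> = Some (A \<restriction> y)" and v: "runs A p [x] v Q" "Q \<subseteq> {..<y}" for \<tau> A y x v Q
  proof -
    let ?c = "str_code (A \<restriction> y)"
    have ex: "\<exists>t. approx p (A \<restriction> y) t [x] \<noteq> 0"
      using eventually_happens'[OF trivial_limit_at_top_linorder approx_complete[OF v]]
      by (metis nat.distinct(1))
    define t where "t = (LEAST t. approx p (A \<restriction> y) t [x] \<noteq> 0)"
    have "approx p (A \<restriction> y) t [x] \<noteq> 0" unfolding t_def by (rule LeastI_ex[OF ex])
    then obtain z where z: "approx p (A \<restriction> y) t [x] = Suc z" using not0_implies_Suc by blast
    have "z = v" using approx_sound[OF z] v(1) runs_deterministic by blast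
    have "\<exists>R. runs {} (Mu pe) [?c, x] t R"
    proof (rule ex_runs_Mu)
      show "\<exists>R. runs {} pe [t, ?c, x] 0 R" using pe[of t ?c x] z by simp
    next
      fix s assume "s < t"
      then have "approx p (A \<restriction> y) s [x] = 0" unfolding t_def using not_less_Least by blast
      then show "\<exists>v R. v > 0 \<and> runs {} pe [s, ?c, x] v R" using pe[of s ?c x] by auto
    qed
    moreover have "\<exists>R. runs {} pv [t, ?c, x] v R" using pv[of t ?c x] z \<open>z = v\<close> by simp
    ultimately have "\<exists>R. runs {} (Comp pv [Mu pe, Proj 0, Proj 1]) [?c, x] v R"
      by (intro ex_runs_Comp3[where z = t and z' = ?c and z'' = x and f = pv] proj) auto
    moreover have "\<exists>R. runs {} (Comp pm [Proj 0]) [str_code \<tau>, x] ?c R"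
      by (rule ex_runs_Comp1[OF proj pm]) (auto simp: m \<tau>)
    ultimately show ?thesis
      unfolding q_def by (intro ex_runs_Comp2[OF _ proj]) auto
  qed
  obtain \<psi> where \<psi>: "partial_recursive2 \<psi>" "\<And>k x y Q. runs {} q [k, x] y Q \<Longrightarrow> \<psi> k x = Some y"
    using partial_recursive2_of_program[of q] by blast
  show ?thesis
  proof (intro exI[of _ \<psi>] conjI allI impI \<psi>(1))
    fix \<tau> A y x v Q
    assume "U \<tau> = Some (A \<restriction> y)" "runs A p [x] v Q" "Q \<subseteq> {..<y}"
    then show "\<psi> (str_code \<tau>) x = Some v" using q \<psi>(2) by blast
  qed
qed

text \<open>Evaluating the function with index \<open>s k\<close> at its own index gives
  \<open>\<psi> k (s k)\<close>. Since \<open>f\<close> avoids the diagonal, \<open>k\<close> can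
  describe a prefix of \<open>A\<close> only of length below \<open>h (s k)\<close>, which is a
  bound of the required form.\<close>

lemma order_function_of_dnr:
  assumes \<phi>: "acceptable_numbering \<phi>" and U: "universal_machine U" and f: "dnr \<phi> f"
    and h: "h \<le>T B" and p: "\<And>x. \<exists>Q\<subseteq>{..<h x}. runs A p [x] (f x) Q"
  shows "\<exists>g. g \<le>T B \<and> mono g \<and> (\<forall>n. \<exists>y. n \<le> g y) \<and> (\<forall>y. g y \<le> plain_complexity U (A \<restriction> y))"
proof -
  have "machine U" using U by (simp add: universal_machine_def)
  then obtain \<psi> where "partial_recursive2 \<psi>" and \<psi>: "\<And>\<tau> A y x v Q. U \<tau> = Some (A \<restriction> y) \<Longrightarrow>
      runs A p [x] v Q \<Longrightarrow> Q \<subseteq> {..<y} \<Longrightarrow> \<psi> (str_code \<tau>) x = Some v"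
    using partial_recursive2_described_oracle[of U p] by blast
  then obtain s where "recursive s" and s: "\<And>e. \<phi> (s e) = \<psi> e"
    using \<phi> unfolding acceptable_numbering_def by blast
  then have s': "computable B 1 (\<lambda>xs. s (xs ! 0))"
    unfolding recursive_iff_computable by (rule_tac computable_mono)
  show ?thesis
  proof (rule order_function_of_bound[OF U, where v = "\<lambda>k. h (s k)"])
    show "computable B 1 (\<lambda>xs. h (s (xs ! 0)))"
      using h s' unfolding turing_le_iff_computable by (rule computable_app1)
    fix \<tau> y assume \<tau>: "U \<tau> = Some (A \<restriction> y)"
    let ?e = "s (str_code \<tau>)"
    show "y < h ?e"
    proof (rule ccontr)
      assume "\<not> y < h ?e"
      moreover obtain Q where Q: "Q \<subseteq> {..<h ?e}" "runs A p [?e] (f ?e) Q" using p by blast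
      ultimately have "Q \<subseteq> {..<y}" by auto
      then have "\<phi> ?e ?e = Some (f ?e)" using \<psi>[OF \<tau> Q(2)] s by simp
      then show False using f unfolding dnr_def by blast
    qed
  qed
qed

section \<open>From complex prefixes to a DNR function\<close>

lemma partial_recursive1_diagonal:
  assumes "partial_recursive2 \<phi>"
  shows "partial_recursive1 (\<lambda>x. \<phi> x x)"
proof -
  obtain p where "oracle_free p"
    and p: "\<And>xs y. length xs = 2 \<Longrightarrow> \<phi> (xs ! 0) (xs ! 1) = Some y \<longleftrightarrow> (\<exists>Q. runs {} p xs y Q)"
    using assms unfolding partial_recursive2_def partial_recursive_def by blast
  have p2: "\<phi> x x = Some y \<longleftrightarrow> (\<exists>Q. runs {} p [x, x] y Q)" for x y
    using p[of "[x, x]" y] by simp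
  have proj: "\<exists>Q. runs {} (Proj 0) [x] x Q" for x
    using runs.Proj[of 0 "[x]" "{}"] by auto
  have comp: "(\<exists>Q. runs {} (Comp p [Proj 0, Proj 0]) [x] y Q) \<longleftrightarrow> (\<exists>Q. runs {} p [x, x] y Q)" for x y
  proof
    assume "\<exists>Q. runs {} (Comp p [Proj 0, Proj 0]) [x] y Q"
    then obtain R where "runs {} (Comp p [Proj 0, Proj 0]) [x] y R" by blast
    then obtain ys Qs Q where ys: "length ys = length [Proj 0, Proj 0]"
      "\<forall>i<length [Proj 0, Proj 0]. runs {} ([Proj 0, Proj 0] ! i) [x] (ys ! i) (Qs i)"
      "runs {} p ys y Q"
      by (rule runs_CompE)
    obtain a b where ab: "ys = [a, b]" using ys(1) by (auto simp: length_Suc_conv)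
    have "runs {} (Proj 0) [x] a (Qs 0)" "runs {} (Proj 0) [x] b (Qs 1)"
      using ys(2)[rule_format, of 0] ys(2)[rule_format, of 1] by (simp_all add: ab)
    then have "ys = [x, x]" by (auto simp: ab elim: runs_ProjE)
    then show "\<exists>Q. runs {} p [x, x] y Q" using ys(3) by blast
  next
    assume "\<exists>Q. runs {} p [x, x] y Q"
    then show "\<exists>Q. runs {} (Comp p [Proj 0, Proj 0]) [x] y Q"
      by (rule ex_runs_Comp2[OF proj proj])
  qed
  show ?thesis
    unfolding partial_recursive1_def partial_recursive_def
  proof (intro exI[of _ "Comp p [Proj 0, Proj 0]"] conjI allI impI)
    show "oracle_free (Comp p [Proj 0, Proj 0])" using \<open>oracle_free p\<close> by simp
    fix xs :: "nat list" and y assume "length xs = 1"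
    then obtain x where "xs = [x]" by (auto simp: length_Suc_conv)
    then show "\<phi> (xs ! 0) (xs ! 0) = Some y \<longleftrightarrow> (\<exists>Q. runs {} (Comp p [Proj 0, Proj 0]) xs y Q)"
      using p2 comp by simp
  qed
qed

text \<open>The machine \<open>M\<close> sends the string with code \<open>x\<close> to the string
  coded by the diagonal value at \<open>x\<close>. The input has length at most \<open>x\<close>, so
  this value has complexity at most \<open>x + c\<close>. As \<open>c\<close> is fixed before
  \<open>F\<close>, a suitable \<open>F\<close> can be chosen afterwards.\<close>

lemma dnr_of_complexity:
  assumes \<phi>: "acceptable_numbering \<phi>" and U: "universal_machine U"
  shows "\<exists>c. \<forall>F. (\<forall>n. n + c < plain_complexity U (A \<restriction> F n)) \<longrightarrow> dnr \<phi> (\<lambda>n. str_code (A \<restriction> F n))"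
proof -
  define M where "M \<sigma> = map_option str_of (\<phi> (str_code \<sigma>) (str_code \<sigma>))" for \<sigma>
  have "partial_recursive1 (\<lambda>x. \<phi> x x)"
    using \<phi> unfolding acceptable_numbering_def by (intro partial_recursive1_diagonal) simp
  then have "machine M" unfolding machine_def
    by (intro exI[of _ "\<lambda>x. \<phi> x x"]) (simp add: M_def option.map_comp comp_def option.map_ident)
  then obtain c where c: "\<And>\<tau> \<sigma>. M \<tau> = Some \<sigma> \<Longrightarrow> \<exists>\<tau>'. U \<tau>' = Some \<sigma> \<and> length \<tau>' \<le> length \<tau> + c"
    using U unfolding universal_machine_def by blast
  have "dnr \<phi> (\<lambda>n. str_code (A \<restriction> F n))"
    if F: "\<And>n. n + c < plain_complexity U (A \<restriction> F n)" for F
    unfolding dnr_def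
  proof (intro allI impI notI)
    fix x y assume "\<phi> x x = Some y" "str_code (A \<restriction> F x) = y"
    then have "M (str_of x) = Some (A \<restriction> F x)" by (auto simp: M_def)
    then obtain \<tau>' where \<tau>': "U \<tau>' = Some (A \<restriction> F x)" "length \<tau>' \<le> length (str_of x) + c"
      using c by blast
    have "length (str_of x) \<le> x" using length_le_str_code[of "str_of x"] by simp
    then show False using plain_complexity_le[of U \<tau>', OF \<tau>'(1)] \<tau>'(2) F[of x] by linarith
  qed
  then show ?thesis by (intro exI[of _ c] allI impI) simp
qed

text \<open>\<open>F n\<close> is found by search in the values of \<open>g\<close>; it is recursive
  in whatever set \<open>B\<close> computes \<open>g\<close>, even though the prefixes are those of
  \<open>A\<close>.\<close>

lemma dnr_of_order_function:
  assumes \<phi>: "acceptable_numbering \<phi>" and U: "universal_machine U"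
    and g: "g \<le>T B" "\<And>n. \<exists>y. n \<le> g y" "\<And>y. g y \<le> plain_complexity U (A \<restriction> y)"
  shows "\<exists>F. F \<le>T B \<and> dnr \<phi> (\<lambda>n. str_code (A \<restriction> F n))"
proof -
  obtain c where c: "\<forall>F. (\<forall>n. n + c < plain_complexity U (A \<restriction> F n)) \<longrightarrow>
      dnr \<phi> (\<lambda>n. str_code (A \<restriction> F n))"
    using dnr_of_complexity[OF \<phi> U, of A] ..
  define F where "F n = (LEAST y. n + c < g y)" for n
  have ex: "\<exists>y. n + c < g y" for n
  proof -
    obtain y where "Suc (n + c) \<le> g y" using g(2) ..
    then show ?thesis by (intro exI[of _ y]) simp
  qed
  have "n + c < g (F n)" for n
    unfolding F_def using ex[of n] by (rule LeastI_ex)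
  then have "\<forall>n. n + c < plain_complexity U (A \<restriction> F n)"
    using g(3) less_le_trans by blast
  with c have "dnr \<phi> (\<lambda>n. str_code (A \<restriction> F n))" by simp
  moreover have "computable B 1 (\<lambda>xs. LEAST y. xs ! 0 + c < g y)"
    by (intro computable_Least ex decidable_less computable_add
        computable_app1[OF g(1)[unfolded turing_le_iff_computable]]
        computable_nth computable_nth_drop computable_const) auto
  then have "F \<le>T B" unfolding turing_le_iff_computable F_def .
  ultimately show ?thesis by blast
qed

text \<open>The length \<open>F n\<close> is computed without the oracle, and the prefix program
  halts for every oracle; their composition is therefore total for all of them.\<close>

lemma tt_le_prefix:
  assumes "F \<le>T {}"
  shows "(\<lambda>n. str_code (A \<restriction> F n)) \<le>tt A"
proof -
  obtain p where p: "\<And>x. \<exists>Q. runs {} p [x] (F x) Q" using assms unfolding turing_le_def by blast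
  obtain q where q: "\<And>X y. \<exists>Q. runs X q [y] (str_code (X \<restriction> y)) Q" using prefix_program by blast
  have "\<exists>Q. runs X (erase p) [x] (F x) Q" for X x using p runs_erase by blast
  from ex_runs_Comp1[OF this q]
  have "\<exists>Q. runs X (Comp q [erase p]) [x] (str_code (X \<restriction> F x)) Q" for X x .
  then show ?thesis unfolding tt_le_def by blast
qed

theorem theorem2p3:
  fixes \<phi> :: "nat \<Rightarrow> nat \<Rightarrow> nat option"
    and U :: "bool list \<Rightarrow> bool list option"
    and A :: "nat set"
  assumes "acceptable_numbering \<phi>"
    and "universal_machine U"
  shows "(autocomplex_set U A \<longleftrightarrow> (\<exists>f. dnr \<phi> f \<and> f \<le>T A)) \<and>
    ((complex_set U A \<longleftrightarrow> (\<exists>f. dnr \<phi> f \<and> f \<le>tt A)) \<and>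
     (complex_set U A \<longleftrightarrow> (\<exists>f. dnr \<phi> f \<and> f \<le>wtt A)))"
proof -
  \<comment> \<open>Recursive means computable from the empty set, so both parts of the theorem are
    instances of the same lemmas, with \<open>B\<close> equal to \<open>A\<close> or
    \<open>{}\<close>.\<close>
  have recursive: "recursive h \<longleftrightarrow> h \<le>T {}" for h
    by (simp add: recursive_iff_computable turing_le_iff_computable)
  have 1: "\<exists>f. dnr \<phi> f \<and> f \<le>T A" if auto: "autocomplex_set U A"
  proof -
    obtain g where "g \<le>T A" "\<And>n. \<exists>y. n \<le> g y" "\<And>y. g y \<le> plain_complexity U (A \<restriction> y)"
      using auto unfolding autocomplex_set_def order_function_in_def by blast
    from dnr_of_order_function[OF assms this]
    obtain F where "F \<le>T A" "dnr \<phi> (\<lambda>n. str_code (A \<restriction> F n))" by blast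
    moreover from this have "(\<lambda>n. str_code (A \<restriction> F n)) \<le>T A"
      unfolding turing_le_iff_computable by (intro computable_prefix)
    ultimately show ?thesis by blast
  qed
  have 2: "autocomplex_set U A" if "dnr \<phi> f" "f \<le>T A" for f
  proof -
    obtain p where "\<And>x. \<exists>Q. runs A p [x] (f x) Q" using \<open>f \<le>T A\<close> unfolding turing_le_def by blast
    from turing_use_bound[of A p f, OF this]
    obtain h where h: "h \<le>T A" "\<And>x. \<exists>Q\<subseteq>{..<h x}. runs A p [x] (f x) Q" by blast
    from order_function_of_dnr[OF assms \<open>dnr \<phi> f\<close> h]
    show ?thesis unfolding autocomplex_set_def order_function_in_def by blast
  qed
  have 3: "\<exists>f. dnr \<phi> f \<and> f \<le>tt A" if complex: "complex_set U A"
  proof -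
    obtain g where "g \<le>T {}" "\<And>n. \<exists>y. n \<le> g y" "\<And>y. g y \<le> plain_complexity U (A \<restriction> y)"
      using complex unfolding complex_set_def order_function_def recursive by blast
    from dnr_of_order_function[OF assms this]
    obtain F where "F \<le>T {}" "dnr \<phi> (\<lambda>n. str_code (A \<restriction> F n))" by blast
    then show ?thesis using tt_le_prefix[of F A] by blast
  qed
  have 4: "complex_set U A" if "dnr \<phi> f" "f \<le>wtt A" for f
  proof -
    obtain p h where h: "h \<le>T {}" and p: "\<And>x. \<exists>Q. runs A p [x] (f x) Q \<and> (\<forall>q\<in>Q. q < h x)"
      using \<open>f \<le>wtt A\<close> unfolding wtt_le_def recursive by blast
    have "\<exists>Q\<subseteq>{..<h x}. runs A p [x] (f x) Q" for x using p[of x] by blast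
    from order_function_of_dnr[OF assms \<open>dnr \<phi> f\<close> h this]
    show ?thesis unfolding complex_set_def order_function_def recursive by blast
  qed
  \<comment> \<open>The second part closes the circle from complex to \<open>tt\<close>, from
    \<open>tt\<close> to \<open>wtt\<close>, and back to complex.\<close>
  show ?thesis using 1 2 3 4 wtt_le_if_tt_le by blast
qed

end
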